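(* Fix $\varepsilon\in(0,\varepsilon_{\max})$, write $\Omega=\Omega_\varepsilon$, $\mathbf B=\mathbf B_\varepsilon$, $\lambda=\lambda_R(\cdot;\varepsilon)$, $w=(w_1,w_2)=w_R(\cdot;\varepsilon)$, and let $v\in\mathbb R$. Put $\vartheta_1(\tau)=(g_1(\tau)-w_1(\tau))\exp(-\int_\tau^v\lambda)$. Let $f$ satisfy the regularity condition stated in the context and $\kappa_3=f'/g_1'$. If $\int_{-\infty}^v\lambda=+\infty$, $\lim_{\tau\to-\infty}\vartheta_1(\tau)>0$ and $\lim_{\tau\to-\infty}\kappa_3(\tau)=-\infty$, then $\mathbf B(x;f)=+\infty$ for every $x\in\Omega\setminus\partial_{\rm fixed}\Omega$.
   Context: Domains. Let $0<\varepsilon_{\max}\le\infty$ and let $\mathbf g(\cdot;\varepsilon)=(\mathbf g_1,\mathbf g_2):\mathbb R\to\mathbb R^2$, $0\le\varepsilon<\varepsilon_{\max}$, be $C^3$ curves, $C^{3,1}$-smooth in $(t,\varepsilon)$ (the mixed derivative $\partial_t^3\partial_\varepsilon\mathbf g$ is continuous), such that for every $\varepsilon$ (primes denote $\partial_t$) $\mathbf g_1'>0$ and $\mathbf g_2''\mathbf g_1'-\mathbf g_2'\mathbf g_1''>0$. Put $g(t)=(g_1(t),g_2(t))=\mathbf g(t;0)$ and $\Xi_\varepsilon=\{(\mathbf g_1(t;\varepsilon),x_2):t\in\mathbb R,\ x_2>\mathbf g_2(t;\varepsilon)\}$. Assume that for $\varepsilon_1<\varepsilon_2$ one has $\Xi_{\varepsilon_1}\supset\Xi_{\varepsilon_2}$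 and $\mathbf g(t;\varepsilon_1)\notin\overline{\Xi_{\varepsilon_2}}$ for all $t$. Assume that for every $\varepsilon\in(0,\varepsilon_{\max})$ and $t\in\mathbb R$ there are two tangent lines from $g(t)$ to $\Xi_\varepsilon$, each meeting the curve $g(\cdot)$ twice. Let $w_L(t;\varepsilon)=\mathbf g(s_L;\varepsilon)$ and $w_R(t;\varepsilon)=\mathbf g(s_R;\varepsilon)$, $s_R<s_L$, be the tangency points, $S_L(t;\varepsilon)=[g(t),w_L(t;\varepsilon)]$, $S_R(t;\varepsilon)=[g(t),w_R(t;\varepsilon)]$ the tangent segments, and $\kappa_L,\kappa_R$ their slopes; assume $\partial_\varepsilon\kappa_L\ne0$, $\partial_\varepsilon\kappa_R\neq 0$ everywhere. Let $T_\varepsilon(t)$ be the closed curvilinear triangle with vertex $g(t)$ bounded by $S_L(t;\varepsilon)$, $S_R(t;\varepsilon)$ and the arc of $\mathbf g(\cdot;\varepsilon)$ between the two tangency points, and $\Omega_\varepsilon=\bigcup_{t}T_\varepsilon(t)$. The fixed boundary is $\partial_{\rm fixed}\Omega_\varepsilon=g(\mathbb R)$. The scalar function $\lambda_R(t;\varepsilon)>0$ is defined by $\lambda_R(t)(g(t)-w_R(t))=w_R'(t)$. Regularity condition on $f:\mathbb R\to\mathbb R$: $f\in C^2(\mathbb R)$ and $\mathfrak K=\kappa_3'/\kappa_2'$ is piecewise monotone with finitely many monotonicity intervals, where $\kappa_2=g_2'/g_1'$, $\kappa_3=f'/g_1'$. The function $\vartheta_1$ is positive and increasing, so its limit at $-\infty$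 exists. Bellman function. For an interval $I$, $\mathbf A_{\Omega_\varepsilon}(I)$ is the class of summable $\varphi:I\to\partial_{\rm fixed}\Omega_\varepsilon$ with average $\langle\varphi\rangle_J\in\Omega_\varepsilon$ for every subinterval $J\subset I$. Let $\mathrm f(g(t))=f(t)$; $\mathbf B_\varepsilon(x;f)=\sup\{\langle \mathrm f(\varphi)\rangle_I:\ \langle\varphi\rangle_I=x,\ \varphi\in\mathbf A_{\Omega_\varepsilon}(I)\}$ (independent of $I$), the supremum being over those $\varphi$ for which the average makes sense in $[-\infty,+\infty]$. *)

theory Defs
  imports "HOL-Analysis.Analysis"
begin

text \<open>
  A family of planar curves is a function \<open>G t \<epsilon>\<close> of the curve parameter \<open>t\<close> and the family
  parameter \<open>\<epsilon>\<close>; the fixed curve is \<open>g t = G t 0\<close>.  The bound \<open>emax\<close> is an extended real, as it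
  may be infinite.
\<close>

definition eps_range :: "ereal \<Rightarrow> real set" where
  "eps_range emax = {\<epsilon>. 0 \<le> \<epsilon> \<and> ereal \<epsilon> < emax}"

text \<open>
  \<open>C\<^sup>3\<^sup>,\<^sup>1\<close>-smoothness: \<open>D j k\<close> is the partial derivative of order \<open>j\<close> in \<open>t\<close> and \<open>k\<close> in \<open>\<epsilon>\<close>
  (one-sided in \<open>\<epsilon>\<close> at \<open>\<epsilon> = 0\<close>), for \<open>j \<le> 3\<close> and \<open>k \<le> 1\<close>.
\<close>

definition C31_smooth :: "ereal \<Rightarrow> (real \<Rightarrow> real \<Rightarrow> real \<times> real) \<Rightarrow> bool" where
  "C31_smooth emax G \<longleftrightarrow>
    (\<exists>D :: nat \<Rightarrow> nat \<Rightarrow> real \<Rightarrow> real \<Rightarrow> real \<times> real.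
       D 0 0 = G \<and>
       (\<forall>j<3. \<forall>k\<le>1. \<forall>t. \<forall>\<epsilon>\<in>eps_range emax.
          ((\<lambda>\<tau>. D j k \<tau> \<epsilon>) has_vector_derivative D (Suc j) k t \<epsilon>) (at t)) \<and>
       (\<forall>j\<le>3. \<forall>t. \<forall>\<epsilon>\<in>eps_range emax.
          ((\<lambda>e. D j 0 t e) has_vector_derivative D j 1 t \<epsilon>) (at \<epsilon> within eps_range emax)) \<and>
       (\<forall>j\<le>3. \<forall>k\<le>1. continuous_on (UNIV \<times> eps_range emax) (\<lambda>(t, \<epsilon>). D j k t \<epsilon>)))"

definition Xi :: "(real \<Rightarrow> real \<Rightarrow> real \<times> real) \<Rightarrow> real \<Rightarrow> (real \<times> real) set" where
  "Xi G \<epsilon> = {(fst (G t \<epsilon>), x2) | t x2. x2 > snd (G t \<epsilon>)}"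

definition fixed_boundary :: "(real \<Rightarrow> real \<Rightarrow> real \<times> real) \<Rightarrow> (real \<times> real) set" where
  "fixed_boundary G = range (\<lambda>t. G t 0)"

definition tangent_line :: "(real \<Rightarrow> real \<Rightarrow> real \<times> real) \<Rightarrow> real \<Rightarrow> real \<Rightarrow> (real \<times> real) set" where
  "tangent_line G \<epsilon> s =
    {G s \<epsilon> + u *\<^sub>R vector_derivative (\<lambda>\<tau>. G \<tau> \<epsilon>) (at s) | u. True}"

text \<open>Parameters of the points of tangency of the tangent lines from \<open>g t\<close>, and these lines.\<close>

definition tangency_params :: "(real \<Rightarrow> real \<Rightarrow> real \<times> real) \<Rightarrow> real \<Rightarrow> real \<Rightarrow> real set" where
  "tangency_params G t \<epsilon> = {s. G t 0 \<in> tangent_line G \<epsilon> s}"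

definition tangent_lines_from ::
    "(real \<Rightarrow> real \<Rightarrow> real \<times> real) \<Rightarrow> real \<Rightarrow> real \<Rightarrow> (real \<times> real) set set" where
  "tangent_lines_from G t \<epsilon> = tangent_line G \<epsilon> ` tangency_params G t \<epsilon>"

text \<open>
  There are exactly two tangency parameters \<open>s\<^sub>R < s\<^sub>L\<close>, so the index \<open>R\<close> refers to the left one
  of the two points of tangency: there the tangent segment goes to the right, towards \<open>g t\<close>.
\<close>

definition s_R :: "(real \<Rightarrow> real \<Rightarrow> real \<times> real) \<Rightarrow> real \<Rightarrow> real \<Rightarrow> real" where
  "s_R G t \<epsilon> = Min (tangency_params G t \<epsilon>)"

definition s_L :: "(real \<Rightarrow> real \<Rightarrow> real \<times> real) \<Rightarrow> real \<Rightarrow> real \<Rightarrow> real" where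
  "s_L G t \<epsilon> = Max (tangency_params G t \<epsilon>)"

definition w_R :: "(real \<Rightarrow> real \<Rightarrow> real \<times> real) \<Rightarrow> real \<Rightarrow> real \<Rightarrow> real \<times> real" where
  "w_R G t \<epsilon> = G (s_R G t \<epsilon>) \<epsilon>"

definition w_L :: "(real \<Rightarrow> real \<Rightarrow> real \<times> real) \<Rightarrow> real \<Rightarrow> real \<Rightarrow> real \<times> real" where
  "w_L G t \<epsilon> = G (s_L G t \<epsilon>) \<epsilon>"

definition slope :: "real \<times> real \<Rightarrow> real \<times> real \<Rightarrow> real" where
  "slope p q = (snd q - snd p) / (fst q - fst p)"

definition kappa_R :: "(real \<Rightarrow> real \<Rightarrow> real \<times> real) \<Rightarrow> real \<Rightarrow> real \<Rightarrow> real" where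
  "kappa_R G t \<epsilon> = slope (G t 0) (w_R G t \<epsilon>)"

definition kappa_L :: "(real \<Rightarrow> real \<Rightarrow> real \<times> real) \<Rightarrow> real \<Rightarrow> real \<Rightarrow> real" where
  "kappa_L G t \<epsilon> = slope (G t 0) (w_L G t \<epsilon>)"

locale curve_family =
  fixes emax :: ereal and G :: "real \<Rightarrow> real \<Rightarrow> real \<times> real"
  assumes emax_pos: "0 < emax"
    and smooth: "C31_smooth emax G"
    and deriv_pos: "\<And>t \<epsilon>. \<epsilon> \<in> eps_range emax \<Longrightarrow> deriv (\<lambda>\<tau>. fst (G \<tau> \<epsilon>)) t > 0"
    and curvature_pos: "\<And>t \<epsilon>. \<epsilon> \<in> eps_range emax \<Longrightarrow>
      (deriv ^^ 2) (\<lambda>\<tau>. snd (G \<tau> \<epsilon>)) t * deriv (\<lambda>\<tau>. fst (G \<tau> \<epsilon>)) t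
        - deriv (\<lambda>\<tau>. snd (G \<tau> \<epsilon>)) t * (deriv ^^ 2) (\<lambda>\<tau>. fst (G \<tau> \<epsilon>)) t > 0"
    and Xi_nested: "\<And>\<epsilon>1 \<epsilon>2. \<lbrakk>\<epsilon>1 \<in> eps_range emax; \<epsilon>2 \<in> eps_range emax; \<epsilon>1 < \<epsilon>2\<rbrakk>
      \<Longrightarrow> Xi G \<epsilon>2 \<subseteq> Xi G \<epsilon>1"
    and Xi_separated: "\<And>\<epsilon>1 \<epsilon>2 t. \<lbrakk>\<epsilon>1 \<in> eps_range emax; \<epsilon>2 \<in> eps_range emax; \<epsilon>1 < \<epsilon>2\<rbrakk>
      \<Longrightarrow> G t \<epsilon>1 \<notin> closure (Xi G \<epsilon>2)"
    and two_tangents: "\<And>t \<epsilon>. \<lbrakk>0 < \<epsilon>; ereal \<epsilon> < emax\<rbrakk> \<Longrightarrow> card (tangent_lines_from G t \<epsilon>) = 2"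
    and tangents_meet_twice: "\<And>t \<epsilon> l. \<lbrakk>0 < \<epsilon>; ereal \<epsilon> < emax; l \<in> tangent_lines_from G t \<epsilon>\<rbrakk>
      \<Longrightarrow> card (l \<inter> fixed_boundary G) = 2"
    and kappa_L_deriv: "\<And>t \<epsilon>. \<lbrakk>0 < \<epsilon>; ereal \<epsilon> < emax\<rbrakk>
      \<Longrightarrow> \<exists>d. ((\<lambda>e. kappa_L G t e) has_real_derivative d) (at \<epsilon>) \<and> d \<noteq> 0"
    and kappa_R_deriv: "\<And>t \<epsilon>. \<lbrakk>0 < \<epsilon>; ereal \<epsilon> < emax\<rbrakk>
      \<Longrightarrow> \<exists>d. ((\<lambda>e. kappa_R G t e) has_real_derivative d) (at \<epsilon>) \<and> d \<noteq> 0"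

text \<open>
  The closed curvilinear triangle: the closed curve made up of the two tangent segments and the
  arc, together with the region it encloses.
\<close>

definition triangle_boundary ::
    "(real \<Rightarrow> real \<Rightarrow> real \<times> real) \<Rightarrow> real \<Rightarrow> real \<Rightarrow> (real \<times> real) set" where
  "triangle_boundary G t \<epsilon> =
    closed_segment (G t 0) (w_L G t \<epsilon>) \<union> closed_segment (G t 0) (w_R G t \<epsilon>)
      \<union> (\<lambda>s. G s \<epsilon>) ` {s_R G t \<epsilon>..s_L G t \<epsilon>}"

definition curv_triangle ::
    "(real \<Rightarrow> real \<Rightarrow> real \<times> real) \<Rightarrow> real \<Rightarrow> real \<Rightarrow> (real \<times> real) set" where
  "curv_triangle G t \<epsilon> = triangle_boundary G t \<epsilon> \<union> inside (triangle_boundary G t \<epsilon>)"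

definition Omega :: "(real \<Rightarrow> real \<Rightarrow> real \<times> real) \<Rightarrow> real \<Rightarrow> (real \<times> real) set" where
  "Omega G \<epsilon> = (\<Union>t. curv_triangle G t \<epsilon>)"

definition lambda_R :: "(real \<Rightarrow> real \<Rightarrow> real \<times> real) \<Rightarrow> real \<Rightarrow> real \<Rightarrow> real" where
  "lambda_R G t \<epsilon> =
    (THE l. l *\<^sub>R (G t 0 - w_R G t \<epsilon>) = vector_derivative (\<lambda>\<tau>. w_R G \<tau> \<epsilon>) (at t))"

text \<open>The interval integral is oriented, so \<open>\<tau> > v\<close> is covered as well.\<close>

definition theta_1 :: "(real \<Rightarrow> real \<Rightarrow> real \<times> real) \<Rightarrow> real \<Rightarrow> real \<Rightarrow> real \<Rightarrow> real" where
  "theta_1 G \<epsilon> v \<tau> =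
    (fst (G \<tau> 0) - fst (w_R G \<tau> \<epsilon>)) * exp (- (LBINT s=ereal \<tau>..ereal v. lambda_R G s \<epsilon>))"

definition kappa_2 :: "(real \<Rightarrow> real \<Rightarrow> real \<times> real) \<Rightarrow> real \<Rightarrow> real" where
  "kappa_2 G t = deriv (\<lambda>\<tau>. snd (G \<tau> 0)) t / deriv (\<lambda>\<tau>. fst (G \<tau> 0)) t"

definition kappa_3 :: "(real \<Rightarrow> real \<Rightarrow> real \<times> real) \<Rightarrow> (real \<Rightarrow> real) \<Rightarrow> real \<Rightarrow> real" where
  "kappa_3 G f t = deriv f t / deriv (\<lambda>\<tau>. fst (G \<tau> 0)) t"

definition C2_smooth :: "(real \<Rightarrow> real) \<Rightarrow> bool" where
  "C2_smooth f \<longleftrightarrow> (\<forall>t. f differentiable (at t)) \<and> (\<forall>t. deriv f differentiable (at t)) \<and>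
     continuous_on UNIV (deriv (deriv f))"

definition piecewise_monotone :: "(real \<Rightarrow> real) \<Rightarrow> bool" where
  "piecewise_monotone h \<longleftrightarrow>
    (\<exists>\<I>. finite \<I> \<and> \<Union>\<I> = UNIV \<and>
       (\<forall>I\<in>\<I>. is_interval I \<and> (mono_on I h \<or> antimono_on I h)))"

definition regular_function ::
    "(real \<Rightarrow> real \<Rightarrow> real \<times> real) \<Rightarrow> (real \<Rightarrow> real) \<Rightarrow> bool" where
  "regular_function G f \<longleftrightarrow> C2_smooth f \<and>
     piecewise_monotone (\<lambda>t. deriv (kappa_3 G f) t / deriv (kappa_2 G) t)"

text \<open>Averages of integrable planar functions over \<open>[c, d]\<close>.\<close>

definition average :: "real \<Rightarrow> real \<Rightarrow> (real \<Rightarrow> real \<times> real) \<Rightarrow> real \<times> real" where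
  "average c d \<phi> = (1 / (d - c)) *\<^sub>R (LINT s:{c..d}|lebesgue. \<phi> s)"

text \<open>
  Averages of scalar functions in \<open>[-\<infinity>, \<infinity>]\<close>.  They make sense if the positive or the negative
  part has finite integral (\<open>ennreal\<close> truncates negative values to \<open>0\<close>).
\<close>

definition has_average :: "real \<Rightarrow> real \<Rightarrow> (real \<Rightarrow> real) \<Rightarrow> bool" where
  "has_average a b h \<longleftrightarrow>
    (\<integral>\<^sup>+s\<in>{a..b}. ennreal (h s) \<partial>lebesgue) < \<infinity> \<or> (\<integral>\<^sup>+s\<in>{a..b}. ennreal (- h s) \<partial>lebesgue) < \<infinity>"

definition ext_average :: "real \<Rightarrow> real \<Rightarrow> (real \<Rightarrow> real) \<Rightarrow> ereal" where
  "ext_average a b h =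
    (enn2ereal (\<integral>\<^sup>+s\<in>{a..b}. ennreal (h s) \<partial>lebesgue)
      - enn2ereal (\<integral>\<^sup>+s\<in>{a..b}. ennreal (- h s) \<partial>lebesgue)) / ereal (b - a)"

definition A_class ::
    "(real \<Rightarrow> real \<Rightarrow> real \<times> real) \<Rightarrow> real \<Rightarrow> real \<Rightarrow> real \<Rightarrow> (real \<Rightarrow> real \<times> real) set" where
  "A_class G \<epsilon> a b =
    {\<phi>. (\<forall>s\<in>{a..b}. \<phi> s \<in> fixed_boundary G) \<and> set_integrable lebesgue {a..b} \<phi> \<and>
        (\<forall>c d. a \<le> c \<longrightarrow> c < d \<longrightarrow> d \<le> b \<longrightarrow> average c d \<phi> \<in> Omega G \<epsilon>)}"

text \<open>The boundary function \<open>f (g t) = f t\<close>; its values off the fixed boundary are irrelevant.\<close>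

definition boundary_fun ::
    "(real \<Rightarrow> real \<Rightarrow> real \<times> real) \<Rightarrow> (real \<Rightarrow> real) \<Rightarrow> real \<times> real \<Rightarrow> real" where
  "boundary_fun G f p = f (inv (\<lambda>t. G t 0) p)"

text \<open>The Bellman function, with the interval \<open>I = [a, b]\<close> as an explicit parameter.\<close>

definition Bellman ::
    "(real \<Rightarrow> real \<Rightarrow> real \<times> real) \<Rightarrow> real \<Rightarrow> real \<Rightarrow> real \<Rightarrow> (real \<Rightarrow> real) \<Rightarrow> real \<times> real \<Rightarrow> ereal"
  where
  "Bellman G \<epsilon> a b f x =
    Sup {ext_average a b (\<lambda>s. boundary_fun G f (\<phi> s)) | \<phi>.
          \<phi> \<in> A_class G \<epsilon> a b \<and> average a b \<phi> = x \<and>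
          has_average a b (\<lambda>s. boundary_fun G f (\<phi> s))}"

end

theory Submission
  imports Defs
begin

text \<open>
  The curve \<open>g\<close> and the curve of parameter \<open>\<epsilon>\<close> bound a strip.  Each point of the strip off \<open>g\<close> lies
  on a segment from a tangency point \<open>w(u)\<close> on the upper curve to \<open>g(u)\<close>, so it equals
  \<open>\<beta> w(u) + (1 - \<beta>) g(u)\<close> with \<open>0 < \<beta> \<le> 1\<close>.  The equation \<open>w' = \<lambda>(g - w)\<close> says how \<open>w(t)\<close> arises as
  an average: with \<open>E(t) = exp(- \<integral>\<^sub>t\<^sup>v \<lambda>)\<close> one has \<open>(E w)' = g E'\<close>, so a function that takes the value
  \<open>g(t)\<close> at a position proportional to \<open>E(t)\<close> keeps its running average at \<open>w(t)\<close>, provided that the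
  running average is \<open>w(\<tau>)\<close> at some starting parameter \<open>\<tau>\<close>.  To reach \<open>w(\<tau>)\<close>, the line through \<open>w(\<tau>)\<close>
  and \<open>g(\<tau>)\<close> is continued to the left until it meets the curve again in some \<open>g(\<sigma>)\<close>, \<open>\<sigma> < \<tau>\<close>, and
  \<open>w(\<tau>)\<close> is written as \<open>\<alpha> g(\<sigma>) + (1 - \<alpha>) g(\<tau>)\<close>.  The test function takes the values \<open>g(\<sigma>)\<close>, \<open>g(\<tau>)\<close>,
  then \<open>g(t)\<close> for \<open>t\<close> from \<open>\<tau>\<close> to \<open>u\<close>, then \<open>g(u)\<close>; its average is the given point
  (\<open>prim_end\<close>).

  It is admissible because its averages over initial intervals run along the chord, then along the
  upper curve, then along the last tangent segment.  The line touching the upper curve at the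
  position reached at time \<open>d\<close> passes through the average over \<open>[a, d]\<close> and has all earlier
  averages above it; hence the average over \<open>[c, d]\<close> lies on or below that line, which is itself
  below the upper curve (\<open>region_averages\<close>).

  The gain comes from the chord.  If \<open>f' \<le> - K g\<^sub>1'\<close> to the left of \<open>\<tau>\<close>, then
  \<open>\<alpha> f(\<sigma>) + (1 - \<alpha>) f(\<tau>)\<close> exceeds \<open>f(\<tau>)\<close> by at least \<open>K (g\<^sub>1(\<tau>) - w\<^sub>1(\<tau>))\<close>, and this enters the average
  with a weight proportional to \<open>E(\<tau>)\<close>, that is, as \<open>K \<vartheta>\<^sub>1(\<tau>)\<close>.  The remaining contribution is bounded
  below independently of \<open>\<tau>\<close>, because \<open>f\<close> is decreasing near \<open>-\<infinity>\<close>.  As \<open>\<tau> \<rightarrow> -\<infinity>\<close>, the factor \<open>\<vartheta>\<^sub>1(\<tau>)\<close>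
  stays above a positive number while \<open>K\<close> may be taken arbitrarily large (\<open>Bellman_infinite\<close>).

  The geometric part identifies \<open>\<Omega>\<close> with the strip between the two graphs (\<open>Omega_eq_region\<close>):
  the curvilinear triangle at \<open>g(t)\<close> contains the vertical segment above \<open>g(t)\<close> up to the upper curve,
  and points off the strip escape to infinity along a vertical ray.
\<close>

section \<open>Real functions of one variable\<close>

lemma strict_mono_by_deriv:
  fixes h h' :: "real \<Rightarrow> real"
  assumes "\<And>t. (h has_real_derivative h' t) (at t)" "\<And>t. h' t > 0"
  shows "strict_mono h"
  unfolding strict_mono_def using assms by (meson DERIV_pos_imp_increasing)

lemma antiderivative_on_line:
  fixes h :: "real \<Rightarrow> real"
  assumes "continuous_on UNIV h"
  obtains H where "\<And>t. (H has_real_derivative h t) (at t)"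
proof -
  have "\<exists>F. \<forall>x::real. - \<infinity> < ereal x \<longrightarrow> ereal x < \<infinity> \<longrightarrow> (F has_vector_derivative h x) (at x)"
    by (rule einterval_antiderivative)
       (use assms in \<open>auto simp: continuous_on_eq_continuous_at\<close>)
  then show ?thesis
    using that by (auto simp: has_real_derivative_iff_has_vector_derivative)
qed

lemma value_between:
  fixes h :: "real \<Rightarrow> real"
  assumes cont: "\<And>t. isCont h t" and ends: "h p \<le> z" "z \<le> h q"
  obtains t where "h t = z"
proof (cases "p \<le> q")
  case True
  then show ?thesis using IVT'[of h p z q] ends cont that
    by (auto simp: continuous_at_imp_continuous_on)
next
  case False
  then show ?thesis using IVT2'[of h p z q] ends cont that
    by (auto simp: continuous_at_imp_continuous_on)
qed

lemma deriv_inv_strict_mono: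
  fixes f f' :: "real \<Rightarrow> real"
  assumes deriv: "\<And>t. (f has_real_derivative f' t) (at t)" and pos: "\<And>t. f' t > 0"
  shows "(inv f has_real_derivative inverse (f' t)) (at (f t))"
proof -
  have mono: "strict_mono f" by (rule strict_mono_by_deriv[OF deriv pos])
  have inv: "inv f (f s) = s" for s using mono by (simp add: strict_mono_imp_inj_on)
  have cont: "isCont f s" for s using deriv by (rule DERIV_isCont)
  show ?thesis
  proof (rule DERIV_inverse_function[where f = f and a = "f (t - 1)" and b = "f (t + 1)"])
    show "(f has_real_derivative f' t) (at (inv f (f t)))" using deriv by (simp add: inv)
    show "f' t \<noteq> 0" using pos[of t] by simp
    show "f (t - 1) < f t" "f t < f (t + 1)" using mono by (simp_all add: strict_mono_less)
    show "f (inv f y) = y" if "f (t - 1) < y" "y < f (t + 1)" for y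
      using value_between[of f "t - 1" y "t + 1"] cont that by (metis inv less_imp_le)
    show "isCont (inv f) (f t)"
      by (rule isCont_inverse_function[of 1]) (auto simp: inv cont)
  qed
qed

section \<open>Convex arcs and their tangent lines\<close>

text \<open>
  A strictly convex graph in parametric form \<open>(X, Y)\<close>; \<open>m\<close> is its slope as a function of the
  parameter.  Working with the slope avoids the second derivatives of \<open>X\<close> and \<open>Y\<close>: strict convexity
  is \<open>m' > 0\<close>.
\<close>

locale convex_arc =
  fixes X Y m X' m' :: "real \<Rightarrow> real"
  assumes deriv_X: "(X has_real_derivative X' t) (at t)"
    and X'_pos: "0 < X' t"
    and deriv_Y: "(Y has_real_derivative m t * X' t) (at t)"
    and deriv_m: "(m has_real_derivative m' t) (at t)"
    and m'_pos: "0 < m' t"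
    and cont_X': "isCont X' t"
    and cont_m': "isCont m' t"
begin

definition tangent :: "real \<Rightarrow> real \<Rightarrow> real" where
  "tangent s z = Y s + m s * (z - X s)"

lemma strict_mono_X: "strict_mono X"
  by (rule strict_mono_by_deriv[OF deriv_X X'_pos])

lemma X_less_iff [simp]: "X s < X t \<longleftrightarrow> s < t"
  and X_le_iff [simp]: "X s \<le> X t \<longleftrightarrow> s \<le> t"
  and X_eq_iff [simp]: "X s = X t \<longleftrightarrow> s = t"
  using strict_mono_X
  by (auto simp: strict_mono_less strict_mono_less_eq strict_mono_eq)

lemma cont_X: "isCont X t"
  and cont_Y: "isCont Y t"
  and cont_m: "isCont m t"
  using deriv_X deriv_Y deriv_m by (blast intro: DERIV_isCont)+

lemma tangent_self [simp]: "tangent t (X t) = Y t"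
  by (simp add: tangent_def)

lemma tangent_affine:
  "tangent s z' = tangent s z + m s * (z' - z)"
  by (simp add: tangent_def algebra_simps)

text \<open>
  This formula carries all comparisons of tangent lines below: at abscissa \<open>z\<close>, the height of the
  tangent line grows with its parameter as long as the point of tangency is to the left of \<open>z\<close>, and
  decreases afterwards.
\<close>

lemma deriv_tangent:
  "((\<lambda>s. tangent s z) has_real_derivative m' s * (z - X s)) (at s)"
  unfolding tangent_def
  by (auto intro!: derivative_eq_intros deriv_X deriv_Y deriv_m simp: algebra_simps)

lemma cont_tangent: "isCont (\<lambda>s. tangent s z) s"
  using deriv_tangent by (rule DERIV_isCont)

lemma tangent_increasing:
  assumes "s1 < s2" "X s2 \<le> z"
  shows "tangent s1 z < tangent s2 z"
proof (rule DERIV_pos_imp_increasing_open[OF \<open>s1 < s2\<close>])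
  fix s assume s: "s1 < s" "s < s2"
  have "X s < z" using s(2) assms(2) X_less_iff[of s s2] by linarith
  then show "\<exists>y. ((\<lambda>s. tangent s z) has_real_derivative y) (at s) \<and> 0 < y"
    using deriv_tangent m'_pos by (intro exI conjI, blast) simp
qed (use cont_tangent continuous_at_imp_continuous_on in blast)

lemma tangent_decreasing:
  assumes "s1 < s2" "z \<le> X s1"
  shows "tangent s2 z < tangent s1 z"
proof (rule DERIV_neg_imp_decreasing_open[OF \<open>s1 < s2\<close>])
  fix s assume s: "s1 < s" "s < s2"
  have "z < X s" using s(1) assms(2) X_less_iff[of s1 s] by linarith
  then show "\<exists>y. ((\<lambda>s. tangent s z) has_real_derivative y) (at s) \<and> y < 0"
    using deriv_tangent m'_pos[of s] by (intro exI conjI, blast) (simp add: mult_less_0_iff)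
qed (use cont_tangent continuous_at_imp_continuous_on in blast)

lemma tangent_less: "s \<noteq> t \<Longrightarrow> tangent s (X t) < Y t"
  using tangent_increasing[of s t "X t"] tangent_decreasing[of t s "X t"]
  by (cases s t rule: linorder_cases) auto

lemma tangent_le: "tangent s (X t) \<le> Y t"
  using tangent_less[of s t] by (cases "s = t") auto

lemma tangency_unique_left:
  assumes "tangent s1 z = tangent s2 z" "X s1 \<le> z" "X s2 \<le> z"
  shows "s1 = s2"
  using assms tangent_increasing[of s1 s2 z] tangent_increasing[of s2 s1 z]
  by (cases s1 s2 rule: linorder_cases) auto

lemma tangency_unique_right:
  assumes "tangent s1 z = tangent s2 z" "z \<le> X s1" "z \<le> X s2"
  shows "s1 = s2"
  using assms tangent_decreasing[of s1 s2 z] tangent_decreasing[of s2 s1 z]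
  by (cases s1 s2 rule: linorder_cases) auto

text \<open>
  A convex arc leaves a secant line upwards at both of its meeting points, so the line can only be
  above the arc between them.
\<close>

lemma secant_line_below:
  assumes line: "\<And>z z'. l z' = l z + \<mu> * (z' - z)"
    and meets: "l (X t) = Y t" "l (X t') = Y t'" "t < t'"
  shows "m t < \<mu>" "\<mu> < m t'"
    "X r < X t \<Longrightarrow> l (X r) < Y r" "X t' < X r \<Longrightarrow> l (X r) < Y r"
proof -
  have eq: "Y t' = Y t + \<mu> * (X t' - X t)" and d: "X t' - X t > 0"
    using line[of "X t'" "X t"] meets by auto
  have "m t * (X t' - X t) < \<mu> * (X t' - X t)"
    using tangent_less[of t t'] meets(3) eq by (simp add: tangent_def)
  then show t: "m t < \<mu>" using d by simp
  have "\<mu> * (X t' - X t) < m t' * (X t' - X t)"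
    using tangent_less[of t' t] meets(3) eq by (simp add: tangent_def algebra_simps)
  then show t': "\<mu> < m t'" using d by simp
  show "l (X r) < Y r" if "X r < X t"
  proof -
    have "\<mu> * (X r - X t) < m t * (X r - X t)" using that t by (simp add: mult_strict_right_mono_neg)
    then show ?thesis using tangent_le[of t r] line[of "X r" "X t"] meets(1) by (simp add: tangent_def)
  qed
  show "l (X r) < Y r" if "X t' < X r"
  proof -
    have "\<mu> * (X r - X t') < m t' * (X r - X t')" using that t' by (simp add: mult_strict_right_mono)
    then show ?thesis using tangent_le[of t' r] line[of "X r" "X t'"] meets(2) by (simp add: tangent_def)
  qed
qed

end

section \<open>The strip between two convex arcs\<close>

text \<open>
  The lower arc \<open>(x, y)\<close> is the fixed boundary, the upper arc \<open>(X, Y)\<close> the free one.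
\<close>

locale convex_strip =
  fixed: convex_arc x y k x' k' + free: convex_arc X Y m X' m'
  for x y k x' k' X Y m X' m' :: "real \<Rightarrow> real" +
  assumes free_over_fixed: "\<exists>t. x t = X s"
    and separated: "x t = X s \<Longrightarrow> y t < Y s"
    and two_tangencies: "\<exists>s1 s2. s1 \<noteq> s2 \<and> free.tangent s1 (x t) = y t \<and> free.tangent s2 (x t) = y t"
    and second_meeting: "free.tangent s (x t) = y t \<Longrightarrow> \<exists>t'. t' \<noteq> t \<and> free.tangent s (x t') = y t'"
begin

text \<open>
  At the abscissa of a point below the upper arc, the tangent height is strictly monotone on either
  side of that abscissa, so two tangencies must be on different sides.
\<close>

lemma tangencies:
  obtains s1 s2 where "s1 < s2" "X s1 < x t" "x t < X s2"
    "free.tangent s1 (x t) = y t" "free.tangent s2 (x t) = y t"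
proof -
  obtain s1 s2 where s: "s1 < s2" "free.tangent s1 (x t) = y t" "free.tangent s2 (x t) = y t"
    using two_tangencies[of t] by (metis linorder_neq_iff)
  moreover have "X s1 < x t"
    using free.tangent_decreasing[of s1 s2 "x t"] s by force
  moreover have "x t < X s2"
    using free.tangent_increasing[of s1 s2 "x t"] s by force
  ultimately show ?thesis using that by blast
qed

lemma fixed_under_free: "\<exists>s. X s = x t"
proof -
  obtain s1 s2 where "X s1 < x t" "x t < X s2" by (rule tangencies)
  then show ?thesis using value_between[of X s1 "x t" s2] free.cont_X by (metis less_imp_le)
qed

lemma tangency_not_above:
  assumes "free.tangent s (x t) = y t" shows "x t \<noteq> X s"
  using separated[of t s] assms by auto

text \<open>
  The tangent line at \<open>s\<close> is strictly above the lower arc at the abscissa of tangency.  A line is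
  above a convex arc only between their two meeting points, so these are on different sides of the
  point of tangency, and at the right one the lower arc is steeper than the line.
\<close>

lemma secant_around_tangency:
  assumes "free.tangent s (x t) = y t"
  obtains t' where "free.tangent s (x t') = y t'"
    "x t' < X s \<and> X s < x t \<and> t' < t \<and> m s < k t \<or> x t < X s \<and> X s < x t' \<and> t < t' \<and> m s < k t'"
proof -
  obtain t' where t': "t' \<noteq> t" "free.tangent s (x t') = y t'"
    using second_meeting[OF assms] by blast
  obtain r where r: "x r = X s" using free_over_fixed by blast
  have above: "\<not> free.tangent s (x r) < y r"
    using separated[OF r] by (simp add: r)
  have neq: "x t \<noteq> X s" "x t' \<noteq> X s"
    using tangency_not_above assms t'(2) by auto
  show ?thesis
  proof (cases "t < t'")
    case True
    note sec = fixed.secant_line_below[of "free.tangent s" "m s" t t', OF free.tangent_affine assms t'(2) True]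
    show ?thesis using that[OF t'(2)] sec above neq True r by (metis linorder_neqE_linordered_idom)
  next
    case False
    then have "t' < t" using t'(1) by simp
    note sec = fixed.secant_line_below[of "free.tangent s" "m s" t' t, OF free.tangent_affine t'(2) assms \<open>t' < t\<close>]
    show ?thesis using that[OF t'(2)] sec above neq \<open>t' < t\<close> r by (metis linorder_neqE_linordered_idom)
  qed
qed

definition R :: "real \<Rightarrow> real" where
  "R t = (THE s. X s < x t \<and> free.tangent s (x t) = y t)"

lemma R_unique: "X s < x t \<Longrightarrow> free.tangent s (x t) = y t \<Longrightarrow> R t = s"
  unfolding R_def by (rule the_equality) (auto intro!: free.tangency_unique_left[of _ "x t" s])

lemma R_props: "X (R t) < x t" "free.tangent (R t) (x t) = y t"
proof -
  obtain s where "X s < x t" "free.tangent s (x t) = y t" by (rule tangencies)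
  then show "X (R t) < x t" "free.tangent (R t) (x t) = y t" using R_unique by auto
qed

lemma slope_R_less: "m (R t) < k t"
  using secant_around_tangency[OF R_props(2)[of t]] R_props(1)[of t] by force

text \<open>
  The tangent height at the abscissa of the lower point passes through the height of that point with
  a strict change of sign at \<open>R t\<close>; the signs persist for nearby lower points and trap their
  tangency parameters.
\<close>

lemma isCont_R: "isCont R t"
  unfolding isCont_def
proof (rule LIM_I)
  fix e :: real assume "e > 0"
  obtain s where s: "X s = x t" using fixed_under_free by blast
  have Rs: "R t < s" using R_props(1)[of t] s by (metis free.X_less_iff)
  define d where "d = min (e/2) ((s - R t) / 2)"
  have d: "d > 0" "d < e" "R t + d < s" using Rs \<open>e > 0\<close> by (auto simp: d_def min_def field_simps)
  have X: "X (R t + d) < x t" using d(3) s by (metis free.X_less_iff)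
  have lo: "free.tangent (R t - d) (x t) - y t < 0"
    using free.tangent_increasing[of "R t - d" "R t" "x t"] R_props[of t] d by simp
  have hi: "free.tangent (R t + d) (x t) - y t > 0"
    using free.tangent_increasing[of "R t" "R t + d" "x t"] R_props[of t] d X by simp
  have c: "isCont (\<lambda>t. free.tangent r (x t) - y t) t" for r
    unfolding free.tangent_def by (intro continuous_intros fixed.cont_X fixed.cont_Y)
  have "\<forall>\<^sub>F t' in at t. free.tangent (R t - d) (x t') - y t' < 0"
    using order_tendstoD(2)[OF c[unfolded isCont_def] lo] .
  moreover have "\<forall>\<^sub>F t' in at t. free.tangent (R t + d) (x t') - y t' > 0"
    using order_tendstoD(1)[OF c[unfolded isCont_def] hi] .
  moreover have "\<forall>\<^sub>F t' in at t. X (R t + d) < x t'"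
    using fixed.cont_X[of t] X by (auto simp: isCont_def intro: order_tendstoD)
  ultimately have "\<forall>\<^sub>F t' in at t. norm (R t' - R t) < e"
  proof eventually_elim
    case (elim t')
    obtain r where r: "R t - d \<le> r" "r \<le> R t + d" "free.tangent r (x t') - y t' = 0"
      using IVT'[of "\<lambda>r. free.tangent r (x t') - y t'" "R t - d" 0 "R t + d"] elim d(1)
        free.cont_tangent by (force intro!: continuous_at_imp_continuous_on continuous_intros)
    have "X r < x t'" using r(2) elim(3) free.X_le_iff[of r "R t + d"] by linarith
    then have "R t' = r" using r(3) by (intro R_unique) auto
    then show ?case using r d(2) by auto
  qed
  then show "\<exists>d>0. \<forall>t'. t' \<noteq> t \<and> norm (t' - t) < d \<longrightarrow> norm (R t' - R t) < e"
    by (auto simp: eventually_at dist_norm)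
qed

text \<open>
  The value obtained by differentiating \<open>tangent (R t) (x t) = y t\<close> implicitly.
\<close>

definition R' :: "real \<Rightarrow> real" where
  "R' t = (k t - m (R t)) * x' t / (m' (R t) * (x t - X (R t)))"

lemma R'_pos: "R' t > 0"
  unfolding R'_def using slope_R_less[of t] R_props(1)[of t] fixed.X'_pos[of t] free.m'_pos[of "R t"]
  by simp

lemma deriv_R: "(R has_real_derivative R' t) (at t)"
proof -
  have ne: "m' (R t) * (x t - X (R t)) \<noteq> 0"
    using R_props(1)[of t] free.m'_pos[of "R t"] by simp
  obtain q where q: "\<And>s. free.tangent s (x t) - free.tangent (R t) (x t) = q s * (s - R t)"
      "isCont q (R t)" "q (R t) = m' (R t) * (x t - X (R t))"
    using free.deriv_tangent[of "x t" "R t"] unfolding DERIV_caratheodory_within by auto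
  have qlim: "((\<lambda>t'. q (R t')) \<longlongrightarrow> m' (R t) * (x t - X (R t))) (at t)"
    using isCont_o2[OF isCont_R q(2)] q(3) by (simp add: isCont_def)
  \<comment> \<open>Only the dependence on the tangency parameter is linearised; the dependence on the abscissa is affine.\<close>
  have eq: "q (R t') * (R t' - R t) = (y t' - y t) - m (R t') * (x t' - x t)" for t'
    using q(1)[of "R t'"] R_props(2)[of t] R_props(2)[of t'] free.tangent_affine[of "R t'" "x t" "x t'"]
    by (simp add: algebra_simps)
  have "((\<lambda>t'. ((y t' - y t) / (t' - t) - m (R t') * ((x t' - x t) / (t' - t))) / q (R t'))
      \<longlongrightarrow> (k t * x' t - m (R t) * x' t) / (m' (R t) * (x t - X (R t)))) (at t)"
  proof (intro tendsto_intros qlim ne)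
    show "((\<lambda>t'. (y t' - y t) / (t' - t)) \<longlongrightarrow> k t * x' t) (at t)"
      using fixed.deriv_Y[of t] by (simp add: has_field_derivative_iff)
    show "((\<lambda>t'. (x t' - x t) / (t' - t)) \<longlongrightarrow> x' t) (at t)"
      using fixed.deriv_X[of t] by (simp add: has_field_derivative_iff)
    show "((\<lambda>t'. m (R t')) \<longlongrightarrow> m (R t)) (at t)"
      using isCont_o2[OF isCont_R free.cont_m] by (simp add: isCont_def)
  qed
  moreover have "\<forall>\<^sub>F t' in at t. ((y t' - y t) / (t' - t) - m (R t') * ((x t' - x t) / (t' - t))) / q (R t')
      = (R t' - R t) / (t' - t)"
  proof -
    have "\<forall>\<^sub>F t' in at t. q (R t') \<noteq> 0" using tendsto_imp_eventually_ne[OF qlim ne] .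
    then show ?thesis using eventually_neq_at_within[of t t UNIV]
    proof eventually_elim
      case (elim t')
      have "((y t' - y t) / (t' - t) - m (R t') * ((x t' - x t) / (t' - t))) = q (R t') * (R t' - R t) / (t' - t)"
        unfolding eq by (simp add: diff_divide_distrib right_diff_distrib)
      then show ?case using elim by simp
    qed
  qed
  ultimately have "((\<lambda>t'. (R t' - R t) / (t' - t)) \<longlongrightarrow> R' t) (at t)"
    unfolding R'_def by (simp add: left_diff_distrib Lim_transform_eventually)
  then show ?thesis by (simp add: has_field_derivative_iff)
qed

lemma R_less_iff [simp]: "R s < R t \<longleftrightarrow> s < t" and R_le_iff [simp]: "R s \<le> R t \<longleftrightarrow> s \<le> t"
  using strict_mono_by_deriv[OF deriv_R R'_pos] by (auto simp: strict_mono_less strict_mono_less_eq)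

text \<open>
  The factor in \<open>w' = \<lambda> (g - w)\<close>, where \<open>w = (X \<circ> R, Y \<circ> R)\<close>: both sides have the direction of the
  tangent line, so the first coordinates determine it.
\<close>

definition lam :: "real \<Rightarrow> real" where
  "lam t = X' (R t) * R' t / (x t - X (R t))"

lemma lam_pos: "lam t > 0"
  unfolding lam_def using R'_pos[of t] R_props(1)[of t] free.X'_pos[of "R t"] by simp

lemma deriv_XR: "((\<lambda>t. X (R t)) has_real_derivative lam t * (x t - X (R t))) (at t)"
proof -
  have "lam t * (x t - X (R t)) = X' (R t) * R' t"
    using R_props(1)[of t] by (simp add: lam_def)
  then show ?thesis using DERIV_chain2[OF free.deriv_X deriv_R, of t] by simp
qed

lemma deriv_YR: "((\<lambda>t. Y (R t)) has_real_derivative lam t * (y t - Y (R t))) (at t)"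
proof -
  have "y t - Y (R t) = m (R t) * (x t - X (R t))"
    using R_props(2)[of t] by (simp add: free.tangent_def)
  then have "lam t * (y t - Y (R t)) = m (R t) * X' (R t) * R' t"
    using R_props(1)[of t] by (simp add: lam_def)
  then show ?thesis using DERIV_chain2[OF free.deriv_Y deriv_R, of t] by simp
qed

lemma cont_lam: "isCont lam t"
proof -
  have ne: "x t - X (R t) \<noteq> 0" "m' (R t) * (x t - X (R t)) \<noteq> 0"
    using R_props(1)[of t] free.m'_pos[of "R t"] by auto
  show ?thesis unfolding lam_def R'_def
    by (intro continuous_intros isCont_o2[OF isCont_R] ne isCont_o2[OF isCont_o2[OF isCont_R]]
        fixed.cont_X fixed.cont_X' fixed.cont_m
        free.cont_X free.cont_X' free.cont_m free.cont_m')
qed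

definition region :: "(real \<times> real) set" where
  "region = {p. \<exists>t s. x t = fst p \<and> X s = fst p \<and> y t \<le> snd p \<and> snd p \<le> Y s}"

lemma in_region_iff:
  assumes "x t = X s" shows "(x t, z) \<in> region \<longleftrightarrow> y t \<le> z \<and> z \<le> Y s"
  using assms unfolding region_def by auto (metis fixed.X_eq_iff free.X_eq_iff)+

text \<open>
  Membership in the strip by two lines only: one touching the lower arc at the same abscissa and an
  arbitrary one touching the upper arc.
\<close>

lemma in_region_by_tangents:
  assumes "x t = z1" "fixed.tangent t z1 \<le> z2" "z2 \<le> free.tangent s z1"
  shows "(z1, z2) \<in> region"
proof -
  obtain r where "X r = x t" using fixed_under_free by blast
  then show ?thesis
    using assms free.tangent_le[of s r] unfolding region_def by fastforce
qed


text \<open>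
  The segments from \<open>(X (R u), Y (R u))\<close> to \<open>(x u, y u)\<close> cover the strip off its lower boundary.  Of
  the lines touching the upper arc to the left of \<open>p\<close>, one passes through \<open>p\<close>, since their heights
  above \<open>p\<close> vary from the lower arc to the upper one.  It meets the lower arc to the right of \<open>p\<close>
  because it is flatter than the other tangent line through the point of the lower arc under \<open>p\<close>,
  which touches the upper arc on the right of \<open>p\<close> and meets the lower arc again further right.
\<close>

lemma region_right_tangent:
  assumes p: "p \<in> region" and off: "\<And>t. p \<noteq> (x t, y t)"
  obtains u \<beta> where "0 < \<beta>" "\<beta> \<le> 1" "fst p = \<beta> * X (R u) + (1 - \<beta>) * x u"
    "snd p = \<beta> * Y (R u) + (1 - \<beta>) * y u"
proof -
  obtain t s0 where t: "x t = fst p" "X s0 = fst p" "y t \<le> snd p" "snd p \<le> Y s0"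
    using p by (auto simp: region_def)
  have above: "y t < snd p" using off[of t] t by (metis order_le_less prod.collapse)
  obtain s1 s2 where s12: "s1 < s2" "X s1 < x t" "x t < X s2"
    "free.tangent s1 (x t) = y t" "free.tangent s2 (x t) = y t" by (rule tangencies)
  have s1s0: "s1 < s0" using s12(2) t by (metis free.X_less_iff)
  obtain s where s: "s1 \<le> s" "s \<le> s0" "free.tangent s (x t) = snd p"
    using IVT'[of "\<lambda>s. free.tangent s (x t)" s1 "snd p" s0] s12 t s1s0 above free.cont_tangent
      continuous_at_imp_continuous_on[of "{s1..s0}" "\<lambda>s. free.tangent s (x t)"]
    by (metis free.tangent_self less_imp_le)
  have Xs: "X s \<le> x t" using s(2) t by (metis free.X_le_iff)
  have ss2: "s < s2" using s(2) s12(3) t by (metis free.X_less_iff order_le_less_trans)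
  obtain t' where t': "free.tangent s2 (x t') = y t'" "X s2 < x t'" "t < t'"
    using secant_around_tangency[OF s12(5)] s12(3) by force
  have hi: "free.tangent s (x t') < y t'"
    using free.tangent_increasing[of s s2 "x t'"] t' ss2 by simp
  obtain u where u: "t \<le> u" "u \<le> t'" "y u - free.tangent s (x u) = 0"
  proof (rule IVT'[of "\<lambda>u. y u - free.tangent s (x u)" t 0 t', THEN exE])
    show "continuous_on {t..t'} (\<lambda>u. y u - free.tangent s (x u))"
      unfolding free.tangent_def
      by (intro continuous_at_imp_continuous_on ballI continuous_intros fixed.cont_X fixed.cont_Y)
  qed (use s(3) above hi t'(3) in auto)
  have "t \<noteq> u" using u s(3) above by auto
  then have xu: "x t < x u" using u(1) by simp
  have Xsu: "X s < x u" using Xs xu by linarith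
  then have Ru: "R u = s" using u(3) by (intro R_unique) auto
  define \<beta> where "\<beta> = (x u - x t) / (x u - X s)"
  have "0 < \<beta>" "\<beta> \<le> 1" using xu Xs Xsu unfolding \<beta>_def by simp_all
  moreover have x: "fst p = \<beta> * X (R u) + (1 - \<beta>) * x u"
  proof -
    have "\<beta> * (x u - X s) = x u - x t" using Xsu by (simp add: \<beta>_def)
    then show ?thesis using Ru t by (simp add: algebra_simps)
  qed
  moreover have "snd p = \<beta> * Y (R u) + (1 - \<beta>) * y u"
  proof -
    have "snd p = Y s + m s * (fst p - X s)" using s(3) t by (simp add: free.tangent_def)
    also have "fst p - X s = (1 - \<beta>) * (x u - X s)" using x Ru by (simp add: algebra_simps)
    also have "m s * ((1 - \<beta>) * (x u - X s)) = (1 - \<beta>) * (m s * (x u - X s))" by simp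
    also have "m s * (x u - X s) = y u - Y s" using u(3) by (simp add: free.tangent_def)
    finally show ?thesis using Ru by (simp add: algebra_simps)
  qed
  ultimately show ?thesis by (rule that)
qed

end

section \<open>Averaging along the right tangents\<close>

text \<open>
  Primitives in integral form, so that they can be glued without regard to differentiability at the
  common end point.
\<close>

definition primitive_on :: "(real \<Rightarrow> real) \<Rightarrow> (real \<Rightarrow> real) \<Rightarrow> real \<Rightarrow> real \<Rightarrow> bool" where
  "primitive_on f F a b \<longleftrightarrow>
    (\<forall>c d. a \<le> c \<longrightarrow> c \<le> d \<longrightarrow> d \<le> b \<longrightarrow> (f has_integral (F d - F c)) {c..d})"

lemma primitive_onD:
  "primitive_on f F a b \<Longrightarrow> a \<le> c \<Longrightarrow> c \<le> d \<Longrightarrow> d \<le> b \<Longrightarrow> (f has_integral (F d - F c)) {c..d}"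
  by (simp add: primitive_on_def)

lemma primitive_on_piece:
  assumes cont: "continuous_on {a..b} P"
    and deriv: "\<And>r. a < r \<Longrightarrow> r < b \<Longrightarrow> (P has_real_derivative f r) (at r)"
    and eq: "\<And>r. a \<le> r \<Longrightarrow> r \<le> b \<Longrightarrow> F r = P r"
  shows "primitive_on f F a b"
  unfolding primitive_on_def
proof (intro allI impI)
  fix c d assume cd: "a \<le> c" "c \<le> d" "d \<le> b"
  have "(f has_integral (P d - P c)) {c..d}"
  proof (rule fundamental_theorem_of_calculus_interior[OF cd(2)])
    show "continuous_on {c..d} P" using cont cd by (auto intro: continuous_on_subset)
    show "(P has_vector_derivative f r) (at r)" if "r \<in> {c<..<d}" for r
      using deriv[of r] that cd by (simp add: has_real_derivative_iff_has_vector_derivative)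
  qed
  then show "(f has_integral (F d - F c)) {c..d}" using eq cd by simp
qed

lemma primitive_on_glue:
  assumes "primitive_on f F a e" "primitive_on f F e b"
  shows "primitive_on f F a b"
  unfolding primitive_on_def
proof (intro allI impI)
  fix c d assume cd: "a \<le> c" "c \<le> d" "d \<le> b"
  consider "d \<le> e" | "e \<le> c" | "c \<le> e" "e \<le> d" by linarith
  then show "(f has_integral (F d - F c)) {c..d}"
  proof cases
    case 3
    have "(f has_integral (F e - F c + (F d - F e))) {c..d}"
      using has_integral_combine[OF 3 primitive_onD[OF assms(1)] primitive_onD[OF assms(2)]] 3 cd by auto
    then show ?thesis by simp
  qed (use assms cd primitive_onD in auto)
qed

text \<open>
  \<open>E\<close> is a multiple of \<open>exp(- \<integral>\<^sub>t\<^sup>v \<lambda>)\<close>.  The line touching the upper arc at \<open>w(\<tau>)\<close>, where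
  \<open>w = (X \<circ> R, Y \<circ> R)\<close>, meets the lower arc at \<open>\<tau>\<close> and at \<open>\<sigma>\<close>, and \<open>w(\<tau>)\<close> divides this chord in
  the ratio given by \<open>\<alpha>\<close>.
\<close>

locale tangential_path = convex_strip +
  fixes E :: "real \<Rightarrow> real" and a b \<sigma> \<tau> u \<alpha> \<beta> :: real
  assumes deriv_E: "\<And>t. (E has_real_derivative lam t * E t) (at t)"
    and E_pos: "\<And>t. E t > 0"
    and a_less_b: "a < b" and order: "\<sigma> < \<tau>" "\<tau> < u"
    and \<alpha>: "0 < \<alpha>" "\<alpha> < 1" and \<beta>: "0 < \<beta>" "\<beta> \<le> 1"
    and chord: "free.tangent (R \<tau>) (x \<sigma>) = y \<sigma>"
    and division: "X (R \<tau>) = \<alpha> * x \<sigma> + (1 - \<alpha>) * x \<tau>"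
begin

text \<open>
  At the point \<open>pos t\<close> of \<open>[a, b]\<close>, the average over \<open>[a, pos t]\<close> is to be \<open>w(t)\<close>.  The scaling places
  \<open>pos u\<close> at the fraction \<open>\<beta>\<close> of the interval.
\<close>

definition pos :: "real \<Rightarrow> real" where "pos t = a + (b - a) * \<beta> * E t / E u"

definition jump :: real where "jump = a + \<alpha> * (pos \<tau> - a)"

text \<open>
  The parameter on the lower arc as a function of the position in \<open>[a, b]\<close>.
\<close>

definition \<theta> :: "real \<Rightarrow> real" where
  "\<theta> r = (if r \<le> jump then \<sigma> else if r \<le> pos \<tau> then \<tau> else if r \<le> pos u then inv pos r else u)"

text \<open>
  For suitable \<open>H\<close>, a primitive of \<open>h \<circ> \<theta>\<close> that vanishes at \<open>a\<close>: on the moving part, \<open>H t\<close> is the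
  average of \<open>h \<circ> \<theta>\<close> over \<open>[a, pos t]\<close>.
\<close>

definition prim :: "(real \<Rightarrow> real) \<Rightarrow> (real \<Rightarrow> real) \<Rightarrow> real \<Rightarrow> real" where
  "prim h H r =
    (if r \<le> jump then (r - a) * h \<sigma>
     else if r \<le> pos \<tau> then (jump - a) * h \<sigma> + (r - jump) * h \<tau>
     else if r \<le> pos u then (r - a) * H (inv pos r)
     else (pos u - a) * H u + (r - pos u) * h u)"

lemma deriv_pos: "(pos has_real_derivative lam t * (pos t - a)) (at t)"
proof -
  have "((\<lambda>t. a + (b - a) * \<beta> / E u * E t) has_real_derivative (b - a) * \<beta> / E u * (lam t * E t)) (at t)"
    using E_pos[of u] by (auto intro!: derivative_eq_intros deriv_E)
  moreover have "pos = (\<lambda>t. a + (b - a) * \<beta> / E u * E t)" by (simp add: pos_def fun_eq_iff)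
  ultimately show ?thesis by (simp add: mult_ac)
qed

lemma pos_gt: "a < pos t"
  using a_less_b \<beta> E_pos[of t] E_pos[of u] by (simp add: pos_def)

lemma speed_pos: "0 < lam t * (pos t - a)"
  using lam_pos[of t] pos_gt[of t] by simp

lemma pos_less_iff [simp]: "pos s < pos t \<longleftrightarrow> s < t"
  and pos_le_iff [simp]: "pos s \<le> pos t \<longleftrightarrow> s \<le> t"
  and inv_pos [simp]: "inv pos (pos t) = t"
  using strict_mono_by_deriv[OF deriv_pos speed_pos]
  by (simp_all add: strict_mono_less strict_mono_less_eq strict_mono_imp_inj_on)

lemma pos_u: "pos u = a + (b - a) * \<beta>"
  using E_pos[of u] by (simp add: pos_def)

lemma breaks: "a < jump" "jump < pos \<tau>" "pos \<tau> < pos u" "pos u \<le> b"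
proof -
  show "a < jump" using \<alpha> pos_gt[of \<tau>] by (simp add: jump_def)
  have "\<alpha> * (pos \<tau> - a) < 1 * (pos \<tau> - a)"
    using \<alpha> pos_gt[of \<tau>] by (intro mult_strict_right_mono) auto
  then show "jump < pos \<tau>" by (simp add: jump_def)
  show "pos \<tau> < pos u" using order by simp
  have "(b - a) * \<beta> \<le> (b - a) * 1" using a_less_b \<beta> by (intro mult_left_mono) auto
  then show "pos u \<le> b" by (simp add: pos_u)
qed

lemma travelling:
  assumes "pos \<tau> \<le> r" "r \<le> pos u"
  obtains t where "\<tau> \<le> t" "t \<le> u" "r = pos t" "inv pos r = t"
proof -
  obtain t where t: "pos t = r"
    using value_between[of pos \<tau> r u] assms deriv_pos DERIV_isCont by metis
  then have "\<tau> \<le> t" "t \<le> u" using assms by auto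
  then show ?thesis using that t by auto
qed

lemma \<theta>_range: "\<sigma> \<le> \<theta> r" "\<theta> r \<le> u"
proof -
  have "\<sigma> \<le> \<theta> r \<and> \<theta> r \<le> u"
  proof (cases "pos \<tau> < r \<and> r \<le> pos u")
    case True
    then have "pos \<tau> \<le> r" "r \<le> pos u" by simp_all
    then obtain t where "\<tau> \<le> t" "t \<le> u" "r = pos t" "inv pos r = t" by (rule travelling)
    then show ?thesis using order by (simp add: \<theta>_def)
  qed (use order in \<open>auto simp: \<theta>_def\<close>)
  then show "\<sigma> \<le> \<theta> r" "\<theta> r \<le> u" by auto
qed

lemma prim_after:
  assumes "pos u \<le> r"
  shows "prim h H r = (pos u - a) * H u + (r - pos u) * h u"
proof (cases "r = pos u")
  case True
  have "inv pos r = u" using True by simp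
  moreover have "\<not> r \<le> jump" "\<not> r \<le> pos \<tau>" using breaks True by linarith+
  ultimately show ?thesis using True unfolding prim_def by simp
next
  case False
  then have "\<not> r \<le> jump" "\<not> r \<le> pos \<tau>" "\<not> r \<le> pos u" using breaks assms by linarith+
  then show ?thesis unfolding prim_def by simp
qed

text \<open>
  Since \<open>pos' = \<lambda> (pos - a)\<close>, the equation \<open>H' = \<lambda> (h - H)\<close> is equivalent to
  \<open>((pos - a) H)' = h pos'\<close>.  The initial condition makes the primitive continuous at \<open>pos \<tau>\<close>.  The
  lemma is applied to the coordinates with \<open>H\<close> a coordinate of \<open>w\<close>, to affine combinations of these,
  and to the boundary function.
\<close>

lemma primitive_along_path:
  assumes H: "\<And>t. (H has_real_derivative lam t * (h t - H t)) (at t)"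
    and start: "H \<tau> = \<alpha> * h \<sigma> + (1 - \<alpha>) * h \<tau>"
  shows "primitive_on (\<lambda>r. h (\<theta> r)) (prim h H) a b"
proof -
  have jump: "(jump - a) * h \<sigma> + (pos \<tau> - jump) * h \<tau> = (pos \<tau> - a) * H \<tau>"
    unfolding start jump_def by (simp add: algebra_simps)
  have p1: "primitive_on (\<lambda>r. h (\<theta> r)) (prim h H) a jump"
  proof (rule primitive_on_piece[where P = "\<lambda>r. (r - a) * h \<sigma>"])
    show "continuous_on {a..jump} (\<lambda>r. (r - a) * h \<sigma>)" by (intro continuous_intros)
    show "prim h H r = (r - a) * h \<sigma>" if "a \<le> r" "r \<le> jump" for r
      using that by (simp add: prim_def)
    show "((\<lambda>r. (r - a) * h \<sigma>) has_real_derivative h (\<theta> r)) (at r)" if "a < r" "r < jump" for r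
      using that by (auto intro!: derivative_eq_intros simp: \<theta>_def)
  qed
  have p2: "primitive_on (\<lambda>r. h (\<theta> r)) (prim h H) jump (pos \<tau>)"
  proof (rule primitive_on_piece[where P = "\<lambda>r. (jump - a) * h \<sigma> + (r - jump) * h \<tau>"])
    show "continuous_on {jump..pos \<tau>} (\<lambda>r. (jump - a) * h \<sigma> + (r - jump) * h \<tau>)"
      by (intro continuous_intros)
    show "prim h H r = (jump - a) * h \<sigma> + (r - jump) * h \<tau>" if "jump \<le> r" "r \<le> pos \<tau>" for r
      using that by (cases "r = jump") (simp_all add: prim_def)
    show "((\<lambda>r. (jump - a) * h \<sigma> + (r - jump) * h \<tau>) has_real_derivative h (\<theta> r)) (at r)"
      if "jump < r" "r < pos \<tau>" for r
      using that by (auto intro!: derivative_eq_intros simp: \<theta>_def)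
  qed
  have deriv: "((\<lambda>r. (r - a) * H (inv pos r)) has_real_derivative h t) (at (pos t))" for t
  proof -
    have "(inv pos has_real_derivative inverse (lam t * (pos t - a))) (at (pos t))"
      by (rule deriv_inv_strict_mono[OF deriv_pos speed_pos])
    then have "((\<lambda>r. H (inv pos r)) has_real_derivative
        (lam t * (h t - H t)) * inverse (lam t * (pos t - a))) (at (pos t))"
      using DERIV_chain2[of H _ "inv pos" "pos t"] H[of t] by simp
    then have "((\<lambda>r. (r - a) * H (inv pos r)) has_real_derivative
        1 * H t + (lam t * (h t - H t)) * inverse (lam t * (pos t - a)) * (pos t - a)) (at (pos t))"
      by (auto intro!: derivative_eq_intros)
    moreover have "(lam t * (h t - H t)) * inverse (lam t * (pos t - a)) * (pos t - a) = h t - H t"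
      using lam_pos[of t] pos_gt[of t] by (simp add: field_simps)
    ultimately show ?thesis by (simp only: mult_1) simp
  qed
  have p3: "primitive_on (\<lambda>r. h (\<theta> r)) (prim h H) (pos \<tau>) (pos u)"
  proof (rule primitive_on_piece[where P = "\<lambda>r. (r - a) * H (inv pos r)"])
    show "continuous_on {pos \<tau>..pos u} (\<lambda>r. (r - a) * H (inv pos r))"
    proof (intro continuous_at_imp_continuous_on ballI)
      fix r assume "r \<in> {pos \<tau>..pos u}"
      then have "pos \<tau> \<le> r" "r \<le> pos u" by simp_all
      then obtain t where "r = pos t" by (rule travelling)
      then show "isCont (\<lambda>r. (r - a) * H (inv pos r)) r" using deriv DERIV_isCont by blast
    qed
    show "((\<lambda>r. (r - a) * H (inv pos r)) has_real_derivative h (\<theta> r)) (at r)"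
      if "pos \<tau> < r" "r < pos u" for r
    proof -
      have "pos \<tau> \<le> r" "r \<le> pos u" using that by simp_all
      then obtain t where "\<tau> \<le> t" "t \<le> u" "r = pos t" "inv pos r = t" by (rule travelling)
      moreover have "\<not> r \<le> jump" "\<not> r \<le> pos \<tau>" using that breaks(2) by linarith+
      ultimately show ?thesis using deriv[of t] that by (simp add: \<theta>_def)
    qed
    show "prim h H r = (r - a) * H (inv pos r)" if r: "pos \<tau> \<le> r" "r \<le> pos u" for r
    proof (cases "r = pos \<tau>")
      case True
      then show ?thesis using jump breaks(2) by (simp add: prim_def)
    next
      case False
      then have "\<not> r \<le> jump" "\<not> r \<le> pos \<tau>" using r breaks(2) by linarith+
      then show ?thesis using r by (simp add: prim_def)
    qed
  qed
  have p4: "primitive_on (\<lambda>r. h (\<theta> r)) (prim h H) (pos u) b"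
  proof (rule primitive_on_piece[where P = "\<lambda>r. (pos u - a) * H u + (r - pos u) * h u"])
    show "((\<lambda>r. (pos u - a) * H u + (r - pos u) * h u) has_real_derivative h (\<theta> r)) (at r)"
      if "pos u < r" "r < b" for r
    proof -
      have "\<not> r \<le> jump" "\<not> r \<le> pos \<tau>" "\<not> r \<le> pos u" using that breaks by linarith+
      then have "\<theta> r = u" by (simp add: \<theta>_def)
      then show ?thesis by (auto intro!: derivative_eq_intros)
    qed
    show "continuous_on {pos u..b} (\<lambda>r. (pos u - a) * H u + (r - pos u) * h u)"
      by (intro continuous_intros)
    show "prim h H r = (pos u - a) * H u + (r - pos u) * h u" if "pos u \<le> r" for r
      using that by (rule prim_after)
  qed
  show ?thesis using primitive_on_glue[OF primitive_on_glue[OF primitive_on_glue[OF p1 p2] p3] p4] .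
qed

lemma prim_start: "prim h H a = 0"
  using breaks by (simp add: prim_def)

lemma prim_end: "prim h H b = (b - a) * (\<beta> * H u + (1 - \<beta>) * h u)"
  using prim_after[OF breaks(4)] by (simp add: pos_u algebra_simps)

lemma division_y: "Y (R \<tau>) = \<alpha> * y \<sigma> + (1 - \<alpha>) * y \<tau>"
proof -
  have y: "y \<sigma> = Y (R \<tau>) + m (R \<tau>) * (x \<sigma> - X (R \<tau>))"
    "y \<tau> = Y (R \<tau>) + m (R \<tau>) * (x \<tau> - X (R \<tau>))"
    using chord R_props(2)[of \<tau>] by (simp_all add: free.tangent_def)
  have "\<alpha> * y \<sigma> + (1 - \<alpha>) * y \<tau>
      = Y (R \<tau>) + m (R \<tau>) * (\<alpha> * x \<sigma> + (1 - \<alpha>) * x \<tau> - X (R \<tau>))"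
    unfolding y by (simp add: algebra_simps)
  then show ?thesis using division by simp
qed

lemma x_\<sigma>_less: "x \<sigma> < X (R \<tau>)"
proof -
  have "(1 - \<alpha>) * x \<sigma> < (1 - \<alpha>) * x \<tau>" using \<alpha> order by simp
  then show ?thesis unfolding division by (simp add: algebra_simps)
qed

lemma primitive_x: "primitive_on (\<lambda>r. x (\<theta> r)) (prim x (\<lambda>t. X (R t))) a b"
  by (rule primitive_along_path[where h = x, OF deriv_XR division])

lemma primitive_y: "primitive_on (\<lambda>r. y (\<theta> r)) (prim y (\<lambda>t. Y (R t))) a b"
  by (rule primitive_along_path[where h = y, OF deriv_YR division_y])

text \<open>
  The average over \<open>[a, r]\<close> lies on the line touching the upper arc at \<open>R (stage r)\<close>.
\<close>

definition stage :: "real \<Rightarrow> real" where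
  "stage r = (if r \<le> pos \<tau> then \<tau> else if r \<le> pos u then inv pos r else u)"

lemma stage_ge: "\<tau> \<le> stage r"
proof (cases "pos \<tau> < r \<and> r \<le> pos u")
  case True
  then have "pos \<tau> \<le> r" "r \<le> pos u" by simp_all
  then obtain t where "\<tau> \<le> t" "t \<le> u" "r = pos t" "inv pos r = t" by (rule travelling)
  then show ?thesis by (simp add: stage_def)
qed (use order in \<open>auto simp: stage_def\<close>)

text \<open>
  The lower bound is the inequality of Jensen, via the tangent line of the lower arc at the abscissa
  of the average.  For the upper bound let \<open>h\<close> be the height above the line touching the upper arc at
  \<open>R (stage d)\<close>.  Its integral over \<open>[a, d]\<close> vanishes, and its integral over \<open>[a, c]\<close> is nonnegative:
  the averages of initial intervals run along the chord from \<open>\<sigma>\<close> and then along the upper arc, both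
  above the line, and after \<open>pos u\<close> along the line itself.
\<close>

lemma region_averages:
  assumes cd: "a \<le> c" "c < d" "d \<le> b"
    and zx: "((\<lambda>r. x (\<theta> r)) has_integral (d - c) * z1) {c..d}"
    and zy: "((\<lambda>r. y (\<theta> r)) has_integral (d - c) * z2) {c..d}"
  shows "(z1, z2) \<in> region"
proof -
  have const: "((\<lambda>r. C) has_integral (d - c) * C) {c..d}" for C :: real
    using has_integral_const_real[of C c d] cd by simp
  have lin: "((\<lambda>r. y (\<theta> r) - (B + M * (x (\<theta> r) - A))) has_integral
      (d - c) * (z2 - (B + M * (z1 - A)))) {c..d}" for A B M
  proof -
    have "((\<lambda>r. y (\<theta> r) - (B + M * (x (\<theta> r) - A))) has_integral
      ((d - c) * z2 - ((d - c) * B + M * ((d - c) * z1 - (d - c) * A)))) {c..d}"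
      by (intro has_integral_diff has_integral_add has_integral_mult_right zx zy const)
    then show ?thesis by (simp add: algebra_simps)
  qed
  have "(d - c) * x \<sigma> \<le> (d - c) * z1"
    by (rule has_integral_le[OF const zx]) (use \<theta>_range in auto)
  moreover have "(d - c) * z1 \<le> (d - c) * x u"
    by (rule has_integral_le[OF zx const]) (use \<theta>_range in auto)
  ultimately have "x \<sigma> \<le> z1" "z1 \<le> x u" using cd by auto
  then obtain t where t: "x t = z1" using value_between[of x \<sigma> z1 u] fixed.cont_X by blast
  have low: "fixed.tangent t z1 \<le> z2"
  proof -
    have "0 \<le> (d - c) * (z2 - (y t + k t * (z1 - x t)))"
      by (rule has_integral_nonneg[OF lin]) (use fixed.tangent_le[of t] in \<open>simp add: fixed.tangent_def\<close>)
    then show ?thesis using cd by (simp add: fixed.tangent_def zero_le_mult_iff)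
  qed
  define s where "s = R (stage d)"
  define h where "h t = y t - free.tangent s (x t)" for t
  define H where "H t = Y (R t) - free.tangent s (X (R t))" for t
  have H': "(H has_real_derivative lam t * (h t - H t)) (at t)" for t
    unfolding H_def h_def free.tangent_def
    by (rule derivative_eq_intros deriv_XR deriv_YR refl)+ (simp add: algebra_simps)
  have H_start: "H \<tau> = \<alpha> * h \<sigma> + (1 - \<alpha>) * h \<tau>"
    unfolding H_def h_def free.tangent_def division division_y by (simp add: algebra_simps)
  have H_nonneg: "H t \<ge> 0" for t unfolding H_def using free.tangent_le by simp
  \<comment> \<open>To the left of their tangency points, tangent lines get lower as the parameter grows.\<close>
  have h_\<sigma>: "h \<sigma> \<ge> 0"
  proof (cases "stage d = \<tau>")
    case True
    then show ?thesis using chord by (simp add: h_def s_def)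
  next
    case False
    then have "R \<tau> < s" using stage_ge[of d] by (simp add: s_def)
    then show ?thesis
      using free.tangent_decreasing[of "R \<tau>" s "x \<sigma>"] x_\<sigma>_less chord by (simp add: h_def)
  qed
  have "prim h H d = 0"
  proof -
    consider "d \<le> pos \<tau>" | "pos \<tau> < d" "d \<le> pos u" | "pos u < d" by linarith
    then show ?thesis
    proof cases
      case 1
      then have "h \<sigma> = 0" "h \<tau> = 0" using chord R_props(2)[of \<tau>] by (simp_all add: h_def s_def stage_def)
      then show ?thesis using 1 by (simp add: prim_def)
    next
      case 2
      then have "H (inv pos d) = 0" by (simp add: H_def s_def stage_def)
      then show ?thesis using 2 breaks by (simp add: prim_def)
    next
      case 3
      then have "s = R u" using breaks(3) by (simp add: s_def stage_def del: pos_less_iff)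
      then have "h u = 0" "H u = 0" using R_props(2)[of u] by (simp_all add: h_def H_def)
      then show ?thesis using 3 prim_after by simp
    qed
  qed
  moreover have "prim h H c \<ge> 0"
  proof -
    consider "c \<le> jump" | "jump < c" "c \<le> pos \<tau>" | "pos \<tau> < c" "c \<le> pos u" | "pos u < c" by linarith
    then show ?thesis
    proof cases
      case 1
      then show ?thesis using cd h_\<sigma> by (simp add: prim_def)
    next
      case 2
      have eq: "(jump - a) * h \<sigma> + (pos \<tau> - jump) * h \<tau> = (pos \<tau> - a) * H \<tau>"
        unfolding H_start jump_def by (simp add: algebra_simps)
      \<comment> \<open>An affine function of \<open>c\<close> that is nonnegative at both ends of \<open>[jump, pos \<tau>]\<close>.\<close>
      have "0 \<le> (jump - a) * h \<sigma> + (c - jump) * h \<tau>"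
      proof (cases "h \<tau> \<ge> 0")
        case True
        then show ?thesis using h_\<sigma> 2 breaks by simp
      next
        case False
        then have "(pos \<tau> - jump) * h \<tau> \<le> (c - jump) * h \<tau>"
          using 2 by (intro mult_right_mono_neg) auto
        moreover have "0 \<le> (pos \<tau> - a) * H \<tau>" using H_nonneg[of \<tau>] pos_gt[of \<tau>] by simp
        ultimately show ?thesis using eq by linarith
      qed
      then show ?thesis using 2 by (simp add: prim_def)
    next
      case 3
      then show ?thesis using H_nonneg cd breaks by (simp add: prim_def)
    next
      case 4
      then have "s = R u" using breaks(3) cd by (simp add: s_def stage_def del: pos_less_iff)
      then have "h u = 0" "H u = 0" using R_props(2)[of u] by (simp_all add: h_def H_def)
      then show ?thesis using 4 prim_after by simp
    qed
  qed
  moreover have "((\<lambda>r. h (\<theta> r)) has_integral (prim h H d - prim h H c)) {c..d}"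
    by (rule primitive_onD[OF primitive_along_path[where h = h and H = H, OF H' H_start]]) (use cd in auto)
  moreover have "((\<lambda>r. h (\<theta> r)) has_integral (d - c) * (z2 - free.tangent s z1)) {c..d}"
    unfolding h_def free.tangent_def by (rule lin)
  ultimately have "(d - c) * (z2 - free.tangent s z1) \<le> 0"
    by (metis has_integral_unique diff_0 neg_le_0_iff_le)
  then have "z2 \<le> free.tangent s z1" using cd by (simp add: mult_le_0_iff)
  then show ?thesis by (rule in_region_by_tangents[OF t low])
qed

text \<open>
  The solution of \<open>H' = \<lambda> (h - H)\<close> with the required initial value, by variation of constants.
\<close>

lemma integral_along_path:
  assumes A: "\<And>t. (A has_real_derivative h t * lam t * E t) (at t)"
  shows "primitive_on (\<lambda>r. h (\<theta> r))
    (prim h (\<lambda>t. (A t - A \<tau> + E \<tau> * (\<alpha> * h \<sigma> + (1 - \<alpha>) * h \<tau>)) / E t)) a b"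
proof (rule primitive_along_path)
  fix t
  let ?N = "\<lambda>t. A t - A \<tau> + E \<tau> * (\<alpha> * h \<sigma> + (1 - \<alpha>) * h \<tau>)"
  have "((\<lambda>t. ?N t / E t) has_real_derivative
      (h t * lam t * E t * E t - ?N t * (lam t * E t)) / (E t * E t)) (at t)"
    using E_pos[of t] by (auto intro!: derivative_eq_intros A deriv_E)
  moreover have "(h t * lam t * E t * E t - ?N t * (lam t * E t)) / (E t * E t) = lam t * (h t - ?N t / E t)"
    using E_pos[of t] by (simp add: field_simps)
  ultimately show "((\<lambda>t. ?N t / E t) has_real_derivative lam t * (h t - ?N t / E t)) (at t)" by simp
qed (use E_pos[of \<tau>] in simp)

end

section \<open>The strip of a family of curves\<close>

definition curve_slope :: "(real \<Rightarrow> real \<Rightarrow> real \<times> real) \<Rightarrow> real \<Rightarrow> real \<Rightarrow> real" where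
  "curve_slope G \<epsilon> t = deriv (\<lambda>\<tau>. snd (G \<tau> \<epsilon>)) t / deriv (\<lambda>\<tau>. fst (G \<tau> \<epsilon>)) t"

context curve_family
begin

lemma derivatives:
  assumes "\<epsilon> \<in> eps_range emax"
  obtains p q p2 q2 where
    "\<And>t. ((\<lambda>\<tau>. G \<tau> \<epsilon>) has_vector_derivative (p t, q t)) (at t)"
    "\<And>t. ((\<lambda>\<tau>. fst (G \<tau> \<epsilon>)) has_real_derivative p t) (at t)"
    "\<And>t. ((\<lambda>\<tau>. snd (G \<tau> \<epsilon>)) has_real_derivative q t) (at t)"
    "\<And>t. (p has_real_derivative p2 t) (at t)" "\<And>t. (q has_real_derivative q2 t) (at t)"
    "\<And>t. isCont p2 t" "\<And>t. isCont q2 t"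
    "deriv (\<lambda>\<tau>. fst (G \<tau> \<epsilon>)) = p" "deriv (\<lambda>\<tau>. snd (G \<tau> \<epsilon>)) = q"
    "\<And>t. 0 < p t" "\<And>t. 0 < q2 t * p t - q t * p2 t"
proof -
  obtain D where D0: "D 0 0 = G" and
    D: "\<And>j k t. j < 3 \<Longrightarrow> k \<le> (1::nat) \<Longrightarrow>
      ((\<lambda>\<tau>. D j k \<tau> \<epsilon>) has_vector_derivative D (Suc j) k t \<epsilon>) (at t)"
    using smooth assms unfolding C31_smooth_def by metis
  have f: "((\<lambda>\<tau>. fst (D j 0 \<tau> \<epsilon>)) has_real_derivative fst (D (Suc j) 0 t \<epsilon>)) (at t)" if "j < 3" for j t
    using bounded_linear.has_vector_derivative[OF bounded_linear_fst D[OF that, of 0]]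
    by (simp add: has_real_derivative_iff_has_vector_derivative)
  have s: "((\<lambda>\<tau>. snd (D j 0 \<tau> \<epsilon>)) has_real_derivative snd (D (Suc j) 0 t \<epsilon>)) (at t)" if "j < 3" for j t
    using bounded_linear.has_vector_derivative[OF bounded_linear_snd D[OF that, of 0]]
    by (simp add: has_real_derivative_iff_has_vector_derivative)
  have df: "deriv (\<lambda>\<tau>. fst (D j 0 \<tau> \<epsilon>)) = (\<lambda>t. fst (D (Suc j) 0 t \<epsilon>))" if "j < 3" for j
    using f[OF that] DERIV_imp_deriv by blast
  have ds: "deriv (\<lambda>\<tau>. snd (D j 0 \<tau> \<epsilon>)) = (\<lambda>t. snd (D (Suc j) 0 t \<epsilon>))" if "j < 3" for j
    using s[OF that] DERIV_imp_deriv by blast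
  show ?thesis
  proof (rule that[of "\<lambda>t. fst (D 1 0 t \<epsilon>)" "\<lambda>t. snd (D 1 0 t \<epsilon>)" "\<lambda>t. fst (D 2 0 t \<epsilon>)" "\<lambda>t. snd (D 2 0 t \<epsilon>)"])
    show "((\<lambda>\<tau>. G \<tau> \<epsilon>) has_vector_derivative (fst (D 1 0 t \<epsilon>), snd (D 1 0 t \<epsilon>))) (at t)" for t
      using D[of 0 0 t] by (simp add: D0)
    show "((\<lambda>\<tau>. fst (G \<tau> \<epsilon>)) has_real_derivative fst (D 1 0 t \<epsilon>)) (at t)"
      "((\<lambda>\<tau>. snd (G \<tau> \<epsilon>)) has_real_derivative snd (D 1 0 t \<epsilon>)) (at t)" for t
      using f[of 0 t] s[of 0 t] by (simp_all add: D0)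
    show "((\<lambda>t. fst (D 1 0 t \<epsilon>)) has_real_derivative fst (D 2 0 t \<epsilon>)) (at t)"
      "((\<lambda>t. snd (D 1 0 t \<epsilon>)) has_real_derivative snd (D 2 0 t \<epsilon>)) (at t)" for t
      using f[of 1 t] s[of 1 t] by (simp_all add: numeral_2_eq_2)
    show "isCont (\<lambda>t. fst (D 2 0 t \<epsilon>)) t" "isCont (\<lambda>t. snd (D 2 0 t \<epsilon>)) t" for t
      using f[of 2 t] s[of 2 t] by (auto intro: DERIV_isCont)
    show dp: "deriv (\<lambda>\<tau>. fst (G \<tau> \<epsilon>)) = (\<lambda>t. fst (D 1 0 t \<epsilon>))"
      and dq: "deriv (\<lambda>\<tau>. snd (G \<tau> \<epsilon>)) = (\<lambda>t. snd (D 1 0 t \<epsilon>))"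
      using df[of 0] ds[of 0] by (simp_all add: D0)
    show "0 < fst (D 1 0 t \<epsilon>)" for t
      using deriv_pos[OF assms, of t] by (simp add: dp)
    show "0 < snd (D 2 0 t \<epsilon>) * fst (D 1 0 t \<epsilon>) - snd (D 1 0 t \<epsilon>) * fst (D 2 0 t \<epsilon>)" for t
      using curvature_pos[OF assms, of t] df[of 1] ds[of 1] by (simp add: dp dq numeral_2_eq_2)
  qed
qed

lemma convex_arc_of_curve:
  assumes "\<epsilon> \<in> eps_range emax"
  shows "convex_arc (\<lambda>t. fst (G t \<epsilon>)) (\<lambda>t. snd (G t \<epsilon>)) (curve_slope G \<epsilon>)
    (deriv (\<lambda>t. fst (G t \<epsilon>))) (deriv (curve_slope G \<epsilon>))"
proof -
  obtain p q p2 q2 where *: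
    "\<And>t. ((\<lambda>\<tau>. fst (G \<tau> \<epsilon>)) has_real_derivative p t) (at t)"
    "\<And>t. ((\<lambda>\<tau>. snd (G \<tau> \<epsilon>)) has_real_derivative q t) (at t)"
    "\<And>t. (p has_real_derivative p2 t) (at t)" "\<And>t. (q has_real_derivative q2 t) (at t)"
    "\<And>t. isCont p2 t" "\<And>t. isCont q2 t"
    "deriv (\<lambda>\<tau>. fst (G \<tau> \<epsilon>)) = p" "deriv (\<lambda>\<tau>. snd (G \<tau> \<epsilon>)) = q"
    "\<And>t. 0 < p t" "\<And>t. 0 < q2 t * p t - q t * p2 t"
    using derivatives[OF assms] by metis
  have slope: "curve_slope G \<epsilon> = (\<lambda>t. q t / p t)"
    by (simp add: curve_slope_def *(7,8) fun_eq_iff)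
  have d: "((\<lambda>t. q t / p t) has_real_derivative (q2 t * p t - q t * p2 t) / (p t * p t)) (at t)" for t
    using *(9)[of t] by (intro DERIV_divide *(3,4)) auto
  then have dd: "deriv (\<lambda>t. q t / p t) = (\<lambda>t. (q2 t * p t - q t * p2 t) / (p t * p t))"
    using DERIV_imp_deriv by blast
  have cont: "isCont p t" "isCont q t" for t using *(3,4) by (auto intro: DERIV_isCont)
  show ?thesis unfolding slope dd *(7)
  proof
    fix t
    have "p t \<noteq> 0" using *(9)[of t] by simp
    then show "isCont (\<lambda>t. (q2 t * p t - q t * p2 t) / (p t * p t)) t"
      by (intro continuous_intros cont *(5,6)) auto
    show "((\<lambda>t. snd (G t \<epsilon>)) has_real_derivative q t / p t * p t) (at t)"
      using *(2)[of t] \<open>p t \<noteq> 0\<close> by simp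
    show "0 < (q2 t * p t - q t * p2 t) / (p t * p t)" using *(9,10)[of t] by simp
  qed (use * d cont in auto)
qed

lemma tangent_line_iff:
  assumes "\<epsilon> \<in> eps_range emax"
  shows "z \<in> tangent_line G \<epsilon> s \<longleftrightarrow>
    convex_arc.tangent (\<lambda>t. fst (G t \<epsilon>)) (\<lambda>t. snd (G t \<epsilon>)) (curve_slope G \<epsilon>) s (fst z) = snd z"
proof -
  interpret convex_arc "\<lambda>t. fst (G t \<epsilon>)" "\<lambda>t. snd (G t \<epsilon>)" "curve_slope G \<epsilon>"
      "deriv (\<lambda>t. fst (G t \<epsilon>))" "deriv (curve_slope G \<epsilon>)"
    by (rule convex_arc_of_curve[OF assms])
  obtain p q where pq:
    "\<And>t. ((\<lambda>\<tau>. G \<tau> \<epsilon>) has_vector_derivative (p t, q t)) (at t)"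
    "deriv (\<lambda>\<tau>. fst (G \<tau> \<epsilon>)) = p" "deriv (\<lambda>\<tau>. snd (G \<tau> \<epsilon>)) = q" "\<And>t. 0 < p t"
    using derivatives[OF assms] by metis
  have v: "vector_derivative (\<lambda>\<tau>. G \<tau> \<epsilon>) (at s) = (p s, q s)"
    using pq(1) by (rule vector_derivative_at)
  have slope: "curve_slope G \<epsilon> s = q s / p s" by (simp add: curve_slope_def pq)
  have p: "p s > 0" by (rule pq(4))
  show ?thesis
  proof
    assume "z \<in> tangent_line G \<epsilon> s"
    then obtain c where "z = G s \<epsilon> + c *\<^sub>R (p s, q s)" by (auto simp: tangent_line_def v)
    then show "tangent s (fst z) = snd z" using p by (simp add: tangent_def slope)
  next
    assume "tangent s (fst z) = snd z"
    then have "z = G s \<epsilon> + ((fst z - fst (G s \<epsilon>)) / p s) *\<^sub>R (p s, q s)"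
      using p by (intro prod_eqI) (simp_all add: tangent_def slope mult.commute)
    then show "z \<in> tangent_line G \<epsilon> s" unfolding tangent_line_def v by blast
  qed
qed

text \<open>
  Nestedness puts the upper arc over the range of abscissae of the lower one, and separation from the
  closed epigraph puts it strictly above.  The other two conditions follow from the two tangent lines
  through each point of the lower arc and from their two meeting points with that arc.
\<close>

lemma convex_strip_of_family:
  assumes "0 < \<epsilon>" "ereal \<epsilon> < emax"
  shows "convex_strip (\<lambda>t. fst (G t 0)) (\<lambda>t. snd (G t 0)) (curve_slope G 0)
    (deriv (\<lambda>t. fst (G t 0))) (deriv (curve_slope G 0))
    (\<lambda>t. fst (G t \<epsilon>)) (\<lambda>t. snd (G t \<epsilon>)) (curve_slope G \<epsilon>)
    (deriv (\<lambda>t. fst (G t \<epsilon>))) (deriv (curve_slope G \<epsilon>))"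
proof -
  have e: "0 \<in> eps_range emax" "\<epsilon> \<in> eps_range emax"
    using emax_pos assms by (auto simp: eps_range_def zero_ereal_def)
  interpret fixed: convex_arc "\<lambda>t. fst (G t 0)" "\<lambda>t. snd (G t 0)" "curve_slope G 0"
      "deriv (\<lambda>t. fst (G t 0))" "deriv (curve_slope G 0)"
    by (rule convex_arc_of_curve[OF e(1)])
  interpret free: convex_arc "\<lambda>t. fst (G t \<epsilon>)" "\<lambda>t. snd (G t \<epsilon>)" "curve_slope G \<epsilon>"
      "deriv (\<lambda>t. fst (G t \<epsilon>))" "deriv (curve_slope G \<epsilon>)"
    by (rule convex_arc_of_curve[OF e(2)])
  note line = tangent_line_iff[OF e(2)]
  show ?thesis
  proof unfold_locales
    fix t s
    have "(fst (G s \<epsilon>), snd (G s \<epsilon>) + 1) \<in> Xi G \<epsilon>" unfolding Xi_def by force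
    then have "(fst (G s \<epsilon>), snd (G s \<epsilon>) + 1) \<in> Xi G 0" using Xi_nested[OF e assms(1)] by blast
    then show "\<exists>t. fst (G t 0) = fst (G s \<epsilon>)" by (auto simp: Xi_def)
    show "snd (G t 0) < snd (G s \<epsilon>)" if eq: "fst (G t 0) = fst (G s \<epsilon>)"
    proof (rule ccontr)
      assume "\<not> snd (G t 0) < snd (G s \<epsilon>)"
      then have above: "snd (G s \<epsilon>) \<le> snd (G t 0)" by simp
      have "(fst (G t 0), snd (G t 0) + inverse (real (Suc n))) \<in> Xi G \<epsilon>" for n
      proof -
        have "0 < inverse (real (Suc n))" by simp
        then have "snd (G s \<epsilon>) < snd (G t 0) + inverse (real (Suc n))" using above by linarith
        then show ?thesis unfolding Xi_def using eq by auto
      qed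
      moreover have "(\<lambda>n. (fst (G t 0), snd (G t 0) + inverse (real (Suc n)))) \<longlonglongrightarrow> (fst (G t 0), snd (G t 0) + 0)"
        by (intro tendsto_intros LIMSEQ_inverse_real_of_nat)
      ultimately have "G t 0 \<in> closure (Xi G \<epsilon>)"
        unfolding closure_sequential by (auto intro!: exI[of _ "\<lambda>n. (fst (G t 0), snd (G t 0) + inverse (real (Suc n)))"])
      then show False using Xi_separated[OF e assms(1)] by blast
    qed
    have "card (tangent_line G \<epsilon> ` tangency_params G t \<epsilon>) = 2"
      using two_tangents[OF assms] by (simp add: tangent_lines_from_def)
    then obtain l1 l2 where l: "tangent_line G \<epsilon> ` tangency_params G t \<epsilon> = {l1, l2}" "l1 \<noteq> l2"
      unfolding card_2_iff by blast
    have "l1 \<in> tangent_line G \<epsilon> ` tangency_params G t \<epsilon>" "l2 \<in> tangent_line G \<epsilon> ` tangency_params G t \<epsilon>"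
      unfolding l(1) by simp_all
    then obtain s1 s2 where s: "s1 \<in> tangency_params G t \<epsilon>" "s2 \<in> tangency_params G t \<epsilon>"
      "l1 = tangent_line G \<epsilon> s1" "l2 = tangent_line G \<epsilon> s2" by blast
    moreover have "s1 \<noteq> s2" using s(3,4) l(2) by blast
    ultimately have "s1 \<noteq> s2 \<and> free.tangent s1 (fst (G t 0)) = snd (G t 0)
        \<and> free.tangent s2 (fst (G t 0)) = snd (G t 0)"
      by (simp add: tangency_params_def line)
    then show "\<exists>s1 s2. s1 \<noteq> s2 \<and> free.tangent s1 (fst (G t 0)) = snd (G t 0)
        \<and> free.tangent s2 (fst (G t 0)) = snd (G t 0)"
      by blast
    show "\<exists>t'. t' \<noteq> t \<and> free.tangent s (fst (G t' 0)) = snd (G t' 0)"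
      if st: "free.tangent s (fst (G t 0)) = snd (G t 0)"
    proof -
      have "tangent_line G \<epsilon> s \<in> tangent_lines_from G t \<epsilon>"
        using st by (simp add: tangent_lines_from_def tangency_params_def line)
      then have "card (tangent_line G \<epsilon> s \<inter> fixed_boundary G) = 2"
        using tangents_meet_twice[OF assms] by blast
      then obtain z1 z2 where z: "tangent_line G \<epsilon> s \<inter> fixed_boundary G = {z1, z2}" "z1 \<noteq> z2"
        unfolding card_2_iff by blast
      then obtain z where "z \<in> {z1, z2}" "z \<noteq> G t 0" by blast
      then have zz: "z \<in> tangent_line G \<epsilon> s" "z \<in> fixed_boundary G" unfolding z(1)[symmetric] by blast+
      then obtain t' where t': "z = G t' 0" unfolding fixed_boundary_def by blast
      then have "t' \<noteq> t" using \<open>z \<noteq> G t 0\<close> by blast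
      moreover have "free.tangent s (fst (G t' 0)) = snd (G t' 0)" using zz(1) line t' by blast
      ultimately show ?thesis by blast
    qed
  qed
qed

end

section \<open>The domain is the strip\<close>

locale family_strip = curve_family +
  fixes \<epsilon> :: real
  assumes \<epsilon>_pos: "0 < \<epsilon>" and \<epsilon>_less: "ereal \<epsilon> < emax"
begin

sublocale convex_strip "\<lambda>t. fst (G t 0)" "\<lambda>t. snd (G t 0)" "curve_slope G 0"
    "deriv (\<lambda>t. fst (G t 0))" "deriv (curve_slope G 0)"
    "\<lambda>t. fst (G t \<epsilon>)" "\<lambda>t. snd (G t \<epsilon>)" "curve_slope G \<epsilon>"
    "deriv (\<lambda>t. fst (G t \<epsilon>))" "deriv (curve_slope G \<epsilon>)"
  by (rule convex_strip_of_family[OF \<epsilon>_pos \<epsilon>_less])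

lemma \<epsilon>_range: "\<epsilon> \<in> eps_range emax"
  using \<epsilon>_pos \<epsilon>_less by (simp add: eps_range_def)

lemma mem_tangency_params: "s \<in> tangency_params G t \<epsilon> \<longleftrightarrow> free.tangent s (fst (G t 0)) = snd (G t 0)"
  by (simp add: tangency_params_def tangent_line_iff[OF \<epsilon>_range])

lemma s_R_eq: "s_R G t \<epsilon> = R t"
  and s_L_props: "fst (G t 0) < fst (G (s_L G t \<epsilon>) \<epsilon>)"
    "free.tangent (s_L G t \<epsilon>) (fst (G t 0)) = snd (G t 0)"
proof -
  obtain s1 s2 where s: "s1 < s2" "fst (G s1 \<epsilon>) < fst (G t 0)" "fst (G t 0) < fst (G s2 \<epsilon>)"
    "free.tangent s1 (fst (G t 0)) = snd (G t 0)" "free.tangent s2 (fst (G t 0)) = snd (G t 0)"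
    by (rule tangencies)
  have only: "s = s1 \<or> s = s2" if "free.tangent s (fst (G t 0)) = snd (G t 0)" for s
    using free.tangency_unique_left[of s "fst (G t 0)" s1] free.tangency_unique_right[of s "fst (G t 0)" s2]
      that s by fastforce
  then have params: "tangency_params G t \<epsilon> = {s1, s2}"
    using s(4,5) only unfolding set_eq_iff mem_tangency_params by blast
  have "s_R G t \<epsilon> = s1" "s_L G t \<epsilon> = s2" using s(1) by (simp_all add: s_R_def s_L_def params)
  then show "s_R G t \<epsilon> = R t" "fst (G t 0) < fst (G (s_L G t \<epsilon>) \<epsilon>)"
    "free.tangent (s_L G t \<epsilon>) (fst (G t 0)) = snd (G t 0)"
    using s R_unique by auto
qed

lemma s_R_less_s_L: "R t < s_L G t \<epsilon>"
  using R_props(1)[of t] s_L_props(1)[of t] free.X_less_iff[of "R t" "s_L G t \<epsilon>"] by linarith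

text \<open>
  Both end points are above every tangent line of the lower arc, hence so is the segment; and it is
  part of a tangent line of the upper arc.
\<close>

lemma tangent_segment_subset_region:
  assumes "free.tangent s (fst (G t 0)) = snd (G t 0)"
  shows "closed_segment (G t 0) (G s \<epsilon>) \<subseteq> region"
proof
  fix z assume "z \<in> closed_segment (G t 0) (G s \<epsilon>)"
  then obtain c where c: "0 \<le> c" "c \<le> 1" "z = (1 - c) *\<^sub>R G t 0 + c *\<^sub>R G s \<epsilon>"
    by (auto simp: in_segment)
  have z: "fst z = (1 - c) * fst (G t 0) + c * fst (G s \<epsilon>)" "snd z = (1 - c) * snd (G t 0) + c * snd (G s \<epsilon>)"
    by (simp_all add: c)
  obtain r where r: "fst (G r 0) = fst (G s \<epsilon>)" using free_over_fixed by blast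
  have "min (fst (G t 0)) (fst (G r 0)) \<le> fst z" "fst z \<le> max (fst (G t 0)) (fst (G r 0))"
    using convex_bound_le[of "fst (G t 0)" "max (fst (G t 0)) (fst (G r 0))" "fst (G r 0)" "1 - c" c]
      convex_bound_le[of "- fst (G t 0)" "- min (fst (G t 0)) (fst (G r 0))" "- fst (G r 0)" "1 - c" c]
      c r z by auto
  then obtain t' where t': "fst (G t' 0) = fst z"
    using value_between[of "\<lambda>t. fst (G t 0)" t "fst z" r] value_between[of "\<lambda>t. fst (G t 0)" r "fst z" t]
      fixed.cont_X by (metis max_def min_def)
  have affine: "A + B * (fst z - C) = (1 - c) * (A + B * (fst (G t 0) - C)) + c * (A + B * (fst (G s \<epsilon>) - C))"
    for A B C by (simp add: z(1) algebra_simps)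
  have "(fst z, snd z) \<in> region"
  proof (rule in_region_by_tangents[OF t'])
    have "fixed.tangent t' (fst (G s \<epsilon>)) \<le> snd (G s \<epsilon>)"
      using fixed.tangent_le[of t' r] separated[OF r] r by simp
    then show "fixed.tangent t' (fst z) \<le> snd z"
      using fixed.tangent_le[of t' t] c(1,2) unfolding fixed.tangent_def affine z(2)
      by (intro add_mono mult_left_mono) auto
    show "snd z \<le> free.tangent s (fst z)"
      using assms unfolding free.tangent_def affine z(2) by simp
  qed
  then show "z \<in> region" by simp
qed

lemma triangle_boundary_subset_region: "triangle_boundary G t \<epsilon> \<subseteq> region"
proof -
  have "G s \<epsilon> \<in> region" for s
  proof -
    obtain r where r: "fst (G r 0) = fst (G s \<epsilon>)" using free_over_fixed by blast
    show ?thesis using in_region_iff[OF r] separated[OF r] r by (metis less_imp_le order_refl prod.collapse)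
  qed
  then show ?thesis
    using tangent_segment_subset_region[OF R_props(2)] tangent_segment_subset_region[OF s_L_props(2)]
    unfolding triangle_boundary_def w_L_def w_R_def s_R_eq by blast
qed

lemma not_in_regionD:
  assumes "p \<notin> region"
  obtains \<eta> where "\<eta> \<noteq> (0::real)" "\<And>r. 0 \<le> r \<Longrightarrow> (fst p, snd p + r * \<eta>) \<notin> region"
proof (cases "\<exists>t s. fst (G t 0) = fst p \<and> fst (G s \<epsilon>) = fst p \<and> snd p \<le> snd (G s \<epsilon>)")
  case True
  then obtain t s where ts: "fst (G t 0) = fst p" "fst (G s \<epsilon>) = fst p" "snd p \<le> snd (G s \<epsilon>)" by blast
  have "\<not> snd (G t 0) \<le> snd p" using in_region_iff[of t s "snd p"] ts assms by auto
  then show ?thesis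
    using in_region_iff[of t s] ts that[of "-1"] by force
next
  case False
  then show ?thesis using that[of 1] unfolding region_def by fastforce
qed

text \<open>
  A point off the strip is joined to infinity by a vertical ray off the strip, and hence off the
  boundary of the triangle.
\<close>

lemma inside_triangle_boundary_subset_region: "inside (triangle_boundary G t \<epsilon>) \<subseteq> region"
proof
  fix p assume p: "p \<in> inside (triangle_boundary G t \<epsilon>)"
  show "p \<in> region"
  proof (rule ccontr)
    assume "p \<notin> region"
    then obtain \<eta> where \<eta>: "\<eta> \<noteq> 0" "\<And>r. 0 \<le> r \<Longrightarrow> (fst p, snd p + r * \<eta>) \<notin> region"
      by (rule not_in_regionD) blast
    define ray where "ray = (\<lambda>r. (fst p, snd p + r * \<eta>)) ` {0..}"
    have "connected ray"
      unfolding ray_def by (intro connected_continuous_image continuous_intros) (simp add: is_interval_connected)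
    moreover have "p \<in> ray" unfolding ray_def by (rule image_eqI[of _ _ 0]) auto
    moreover have "ray \<subseteq> - triangle_boundary G t \<epsilon>"
      using \<eta>(2) triangle_boundary_subset_region unfolding ray_def by fastforce
    ultimately have "ray \<subseteq> connected_component_set (- triangle_boundary G t \<epsilon>) p"
      by (meson connected_component_maximal)
    then have "bounded ray" using p by (auto simp: inside_def intro: bounded_subset)
    then obtain B where B: "\<And>q. q \<in> ray \<Longrightarrow> norm q \<le> B" by (auto simp: bounded_iff)
    define r where "r = (\<bar>snd p\<bar> + \<bar>B\<bar> + 1) / \<bar>\<eta>\<bar>"
    have "r \<ge> 0" by (simp add: r_def)
    then have "(fst p, snd p + r * \<eta>) \<in> ray" unfolding ray_def by blast
    then have "\<bar>snd p + r * \<eta>\<bar> \<le> B"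
      using B[of "(fst p, snd p + r * \<eta>)"] norm_snd_le[of "snd p + r * \<eta>" "fst p"] by simp
    moreover have "\<bar>r * \<eta>\<bar> = \<bar>snd p\<bar> + \<bar>B\<bar> + 1" using \<eta>(1) by (simp add: r_def abs_mult)
    ultimately show False by linarith
  qed
qed

lemma on_tangent_segment:
  assumes tangent: "free.tangent s (fst (G t 0)) = snd (G t 0)"
    and q: "snd q = free.tangent s (fst q)"
    and between: "fst q \<in> closed_segment (fst (G t 0)) (fst (G s \<epsilon>))"
  shows "q \<in> closed_segment (G t 0) (G s \<epsilon>)"
proof -
  obtain c where c: "0 \<le> c" "c \<le> 1" "fst q = (1 - c) * fst (G t 0) + c * fst (G s \<epsilon>)"
    using between by (auto simp: in_segment)
  have "snd q = (1 - c) * free.tangent s (fst (G t 0)) + c * free.tangent s (fst (G s \<epsilon>))"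
    unfolding q c(3) free.tangent_def by (simp add: algebra_simps)
  then have "q = (1 - c) *\<^sub>R G t 0 + c *\<^sub>R G s \<epsilon>"
    using c(3) tangent by (intro prod_eqI) simp_all
  then show ?thesis using c by (auto simp: in_segment)
qed

text \<open>
  The open set \<open>U\<close> of the points above both tangent lines and below the upper arc is bounded, and its
  frontier is contained in the boundary of the triangle.  So a component of the complement of that
  boundary which meets \<open>U\<close> stays in \<open>U\<close>.
\<close>

lemma region_column_subset_triangle:
  assumes p: "p \<in> region" and t: "fst (G t 0) = fst p"
  shows "p \<in> curv_triangle G t \<epsilon>"
proof (cases "p \<in> triangle_boundary G t \<epsilon>")
  case True
  then show ?thesis by (simp add: curv_triangle_def)
next
  case False
  let ?TB = "triangle_boundary G t \<epsilon>"
  define l where "l = s_L G t \<epsilon>"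
  define X where "X = (\<lambda>s. fst (G s \<epsilon>))"
  have X: "X (R t) < fst p" "fst p < X l"
    using R_props(1)[of t] s_L_props(1)[of t] by (simp_all add: t X_def l_def)
  have RL: "R t < l" using s_R_less_s_L by (simp add: l_def)
  have arc: "q \<in> ?TB" if "q = G s \<epsilon>" "R t \<le> s" "s \<le> l" for q s
    using that by (auto simp: triangle_boundary_def s_R_eq l_def)
  \<comment> \<open>The upper arc as a graph over the abscissa.\<close>
  define Q where "Q z = snd (G (inv X z) \<epsilon>)" for z
  have "inj X"
    using strict_mono_imp_inj_on[OF free.strict_mono_X] unfolding X_def .
  then have inv: "inv X (X s) = s" for s by (rule inv_f_f)
  have Q: "Q (X s) = snd (G s \<epsilon>)" for s by (simp add: Q_def inv)
  have foot: "\<exists>s. z = X s \<and> R t \<le> s \<and> s \<le> l" if z: "z \<in> {X (R t)..X l}" for z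
  proof -
    obtain s where "X s = z"
      using value_between[of X "R t" z l] free.cont_X z unfolding X_def by auto
    then show ?thesis using z unfolding X_def by auto
  qed
  have contQ: "isCont Q z" if z: "z \<in> {X (R t)..X l}" for z
  proof -
    obtain s where s: "z = X s" using foot[OF z] by blast
    have "isCont (inv X) z"
      unfolding s X_def using deriv_inv_strict_mono[OF free.deriv_X free.X'_pos] by (rule DERIV_isCont)
    then show ?thesis unfolding Q_def
      using isCont_o2[where g = "\<lambda>s. snd (G s \<epsilon>)", OF _ free.cont_Y] by blast
  qed
  define strip ostrip where "strip = {X (R t)..X l} \<times> (UNIV :: real set)"
    and "ostrip = {X (R t)<..<X l} \<times> (UNIV :: real set)"
  define below where "below q = snd q - Q (fst q)" for q
  have contQ_on: "continuous_on {X (R t)..X l} Q"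
    by (intro continuous_at_imp_continuous_on ballI contQ)
  have "continuous_on strip (\<lambda>q. Q (fst q))"
    by (rule continuous_on_compose2[OF contQ_on continuous_on_fst[OF continuous_on_id]])
      (auto simp: strip_def)
  then have cont_below: "continuous_on strip below"
    unfolding below_def by (rule continuous_on_diff[OF continuous_on_snd[OF continuous_on_id]])
  define U where "U = (ostrip \<inter> below -` {..<0})
      \<inter> {q. free.tangent (R t) (fst q) < snd q} \<inter> {q. free.tangent l (fst q) < snd q}"
  define K where "K = (strip \<inter> below -` {..0})
      \<inter> {q. free.tangent (R t) (fst q) \<le> snd q} \<inter> {q. free.tangent l (fst q) \<le> snd q}"
  have cont_tangent: "continuous_on UNIV (\<lambda>q. free.tangent s (fst q))" for s
    unfolding free.tangent_def by (intro continuous_intros)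
  have open_below: "open (ostrip \<inter> below -` {..<0})"
    by (rule continuous_open_preimage[OF continuous_on_subset[OF cont_below]])
      (auto simp: ostrip_def strip_def open_Times)
  have "open U"
    unfolding U_def by (rule open_Int[OF open_Int[OF open_below]]; intro open_Collect_less cont_tangent continuous_on_snd continuous_on_id)
  have closed_below: "closed (strip \<inter> below -` {..0})"
    by (rule continuous_closed_preimage[OF cont_below]) (auto simp: strip_def closed_Times)
  have "closed K"
    unfolding K_def by (rule closed_Int[OF closed_Int[OF closed_below]]; intro closed_Collect_le cont_tangent continuous_on_snd continuous_on_id)
  have "U \<subseteq> K" by (auto simp: U_def K_def ostrip_def strip_def)
  have slopes: "curve_slope G \<epsilon> (R t) < curve_slope G \<epsilon> l"
    using strict_mono_by_deriv[OF free.deriv_m free.m'_pos] RL by (simp add: strict_mono_less)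
  have through: "free.tangent s z = snd (G t 0) + curve_slope G \<epsilon> s * (z - fst p)"
    if "free.tangent s (fst (G t 0)) = snd (G t 0)" for s z
    using free.tangent_affine[of s z "fst (G t 0)"] that t by simp
  note through_R = through[OF R_props(2)] and through_L = through[OF s_L_props(2), folded l_def]
  have "K - U \<subseteq> ?TB"
  proof
    fix q assume q: "q \<in> K - U"
    then have in_strip: "fst q \<in> {X (R t)..X l}" by (auto simp: K_def strip_def)
    then obtain s where s: "fst q = X s" "R t \<le> s" "s \<le> l" using foot by blast
    have q_le: "snd q \<le> snd (G s \<epsilon>)" "free.tangent (R t) (X s) \<le> snd q" "free.tangent l (X s) \<le> snd q"
      using q by (auto simp: K_def below_def s(1) Q)
    have "\<not> (X (R t) < X s \<and> X s < X l \<and> snd q < snd (G s \<epsilon>)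
        \<and> free.tangent (R t) (X s) < snd q \<and> free.tangent l (X s) < snd q)"
      using q unfolding U_def ostrip_def below_def by (simp add: s(1) Q mem_Times_iff)
    moreover have "s = R t \<or> X (R t) < X s" "s = l \<or> X s < X l"
      using s(2,3) unfolding X_def by auto
    ultimately consider "s = R t" | "s = l" | "snd q = snd (G s \<epsilon>)"
      | "snd q = free.tangent (R t) (fst q)" "snd q \<ge> free.tangent l (fst q)"
      | "snd q = free.tangent l (fst q)" "snd q \<ge> free.tangent (R t) (fst q)"
      using q_le unfolding s(1) by linarith
    then show "q \<in> ?TB"
    proof cases
      case 1
      then have "q = G s \<epsilon>" using q_le s(1) free.tangent_self[of "R t"]
        unfolding X_def by (intro prod_eqI) auto
      then show ?thesis using arc s by blast
    next
      case 2
      then have "q = G s \<epsilon>" using q_le s(1) free.tangent_self[of l]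
        unfolding X_def by (intro prod_eqI) auto
      then show ?thesis using arc s by blast
    next
      case 3
      then have "q = G s \<epsilon>" using s(1) unfolding X_def by (intro prod_eqI) auto
      then show ?thesis using arc s by blast
    next
      case 4
      \<comment> \<open>The line of smaller slope is the higher one only to the left of their common point \<open>g(t)\<close>.\<close>
      have "(curve_slope G \<epsilon> l - curve_slope G \<epsilon> (R t)) * (fst q - fst p) \<le> 0"
        using 4 unfolding through_R through_L by (simp add: algebra_simps)
      then have "fst q \<le> fst p" using slopes by (simp add: mult_le_0_iff)
      then have "fst q \<in> closed_segment (fst (G t 0)) (fst (G (R t) \<epsilon>))"
        using in_strip X t by (auto simp: closed_segment_eq_real_ivl X_def)
      then show ?thesis
        using on_tangent_segment[OF R_props(2) 4(1)] by (simp add: triangle_boundary_def w_R_def s_R_eq)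
    next
      case 5
      have "0 \<le> (curve_slope G \<epsilon> l - curve_slope G \<epsilon> (R t)) * (fst q - fst p)"
        using 5 unfolding through_R through_L by (simp add: algebra_simps)
      then have "fst p \<le> fst q" using slopes by (simp add: zero_le_mult_iff)
      then have "fst q \<in> closed_segment (fst (G t 0)) (fst (G l \<epsilon>))"
        using in_strip X t by (auto simp: closed_segment_eq_real_ivl X_def)
      then show ?thesis
        using on_tangent_segment[OF s_L_props(2), folded l_def] 5(1)
        by (simp add: triangle_boundary_def w_L_def l_def)
    qed
  qed
  have "frontier U \<subseteq> ?TB"
    using closure_minimal[OF \<open>U \<subseteq> K\<close> \<open>closed K\<close>] \<open>K - U \<subseteq> ?TB\<close> \<open>open U\<close>
    by (auto simp: frontier_def interior_open)
  have "p \<in> U"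
  proof -
    obtain s where s: "fst p = X s" "R t \<le> s" "s \<le> l" using foot[of "fst p"] X by auto
    have ps: "snd (G t 0) \<le> snd p" "snd p \<le> snd (G s \<epsilon>)"
    proof -
      have "(fst (G t 0), snd p) \<in> region" using p t by simp
      moreover have "fst (G t 0) = fst (G s \<epsilon>)" using s(1) t by (simp add: X_def)
      ultimately show "snd (G t 0) \<le> snd p" "snd p \<le> snd (G s \<epsilon>)" using in_region_iff by blast+
    qed
    have "G t 0 \<in> ?TB" "G s \<epsilon> \<in> ?TB" using arc s by (auto simp: triangle_boundary_def)
    then have "p \<noteq> G t 0" "p \<noteq> G s \<epsilon>" using False by auto
    then have "snd p \<noteq> snd (G t 0)" "snd p \<noteq> snd (G s \<epsilon>)"
      using t s(1) by (auto simp: prod_eq_iff X_def)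
    then have "snd (G t 0) < snd p" "snd p < snd (G s \<epsilon>)" using ps by auto
    then show ?thesis using X s(1) through_R[of "fst p"] through_L[of "fst p"]
      by (auto simp: U_def ostrip_def below_def Q mem_Times_iff)
  qed
  have "bounded K"
  proof -
    have "compact (Q ` {X (R t)..X l})"
      by (rule compact_continuous_image[OF contQ_on]) simp
    then obtain B1 where "\<forall>w\<in>Q ` {X (R t)..X l}. norm w \<le> B1"
      using compact_imp_bounded bounded_iff by blast
    then have B1: "\<bar>Q z\<bar> \<le> B1" if "z \<in> {X (R t)..X l}" for z using that by simp
    have "compact (free.tangent (R t) ` {X (R t)..X l})"
      unfolding free.tangent_def by (intro compact_continuous_image continuous_intros) auto
    then obtain B2 where "\<forall>w\<in>free.tangent (R t) ` {X (R t)..X l}. norm w \<le> B2"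
      using compact_imp_bounded bounded_iff by blast
    then have B2: "\<bar>free.tangent (R t) z\<bar> \<le> B2" if "z \<in> {X (R t)..X l}" for z using that by simp
    have "K \<subseteq> {X (R t)..X l} \<times> {-B2..B1}"
    proof
      fix q assume q: "q \<in> K"
      then have z: "fst q \<in> {X (R t)..X l}" by (auto simp: K_def strip_def)
      have "snd q \<le> Q (fst q)" "free.tangent (R t) (fst q) \<le> snd q"
        using q by (auto simp: K_def below_def)
      then have "snd q \<in> {-B2..B1}" using B1[OF z] B2[OF z] by auto
      then show "q \<in> {X (R t)..X l} \<times> {-B2..B1}" using z by (simp add: mem_Times_iff)
    qed
    then show ?thesis by (rule bounded_subset[rotated]) (simp add: bounded_Times)
  qed
  have "connected_component_set (- ?TB) p \<subseteq> U"
  proof (rule ccontr)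
    assume "\<not> connected_component_set (- ?TB) p \<subseteq> U"
    moreover have "p \<in> connected_component_set (- ?TB) p" using False by simp
    ultimately have "connected_component_set (- ?TB) p \<inter> frontier U \<noteq> {}"
      using \<open>p \<in> U\<close> by (intro connected_Int_frontier[OF connected_connected_component]) blast+
    then show False
      using \<open>frontier U \<subseteq> ?TB\<close> connected_component_subset[of "- ?TB" p] by blast
  qed
  then have "bounded (connected_component_set (- ?TB) p)"
    using \<open>bounded K\<close> \<open>U \<subseteq> K\<close> by (meson bounded_subset)
  then show ?thesis using False by (simp add: curv_triangle_def inside_def)
qed

lemma Omega_eq_region: "Omega G \<epsilon> = region"
proof
  show "Omega G \<epsilon> \<subseteq> region"
    using triangle_boundary_subset_region inside_triangle_boundary_subset_region
    by (auto simp: Omega_def curv_triangle_def)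
  show "region \<subseteq> Omega G \<epsilon>"
  proof
    fix p assume p: "p \<in> region"
    then obtain t where "fst (G t 0) = fst p" by (auto simp: region_def)
    then show "p \<in> Omega G \<epsilon>" using region_column_subset_triangle[OF p] by (auto simp: Omega_def)
  qed
qed

text \<open>
  The difference \<open>g - w\<close> does not vanish, so it determines its multiple.
\<close>

lemma lambda_R_eq: "lambda_R G t \<epsilon> = lam t"
proof -
  have w: "w_R G \<tau> \<epsilon> = (fst (G (R \<tau>) \<epsilon>), snd (G (R \<tau>) \<epsilon>))" for \<tau>
    by (simp add: w_R_def s_R_eq)
  have "((\<lambda>\<tau>. w_R G \<tau> \<epsilon>) has_vector_derivative
      (lam t * (fst (G t 0) - fst (G (R t) \<epsilon>)), lam t * (snd (G t 0) - snd (G (R t) \<epsilon>)))) (at t)"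
    unfolding w using deriv_XR[of t] deriv_YR[of t]
    by (intro has_vector_derivative_Pair) (simp_all add: has_real_derivative_iff_has_vector_derivative)
  also have "(lam t * (fst (G t 0) - fst (G (R t) \<epsilon>)), lam t * (snd (G t 0) - snd (G (R t) \<epsilon>)))
      = lam t *\<^sub>R (G t 0 - w_R G t \<epsilon>)"
    by (simp add: w prod_eq_iff)
  finally have v: "vector_derivative (\<lambda>\<tau>. w_R G \<tau> \<epsilon>) (at t) = lam t *\<^sub>R (G t 0 - w_R G t \<epsilon>)"
    by (rule vector_derivative_at)
  have "G t 0 - w_R G t \<epsilon> \<noteq> 0" using R_props(1)[of t] by (auto simp: w prod_eq_iff)
  then show ?thesis unfolding lambda_R_def v by (intro the_equality) auto
qed

end

section \<open>Admissible test functions and the Bellman function\<close>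

lemma ext_average_eq:
  assumes h: "set_integrable lebesgue {a..b} h" and V: "(h has_integral V) {a..b}" and ab: "a < b"
  shows "has_average a b h" "ext_average a b h = ereal (V / (b - a))"
proof -
  define h0 where "h0 = (\<lambda>s. indicat_real {a..b} s *\<^sub>R h s)"
  have int: "integrable lebesgue h0" using h by (simp add: set_integrable_def h0_def)
  have p: "(\<integral>\<^sup>+s\<in>{a..b}. ennreal (h s) \<partial>lebesgue) = (\<integral>\<^sup>+s. ennreal (h0 s) \<partial>lebesgue)"
    and n: "(\<integral>\<^sup>+s\<in>{a..b}. ennreal (- h s) \<partial>lebesgue) = (\<integral>\<^sup>+s. ennreal (- h0 s) \<partial>lebesgue)"
    by (auto intro!: nn_integral_cong simp: h0_def indicator_def)
  have fin: "(\<integral>\<^sup>+s. ennreal (h0 s) \<partial>lebesgue) \<noteq> \<infinity>" "(\<integral>\<^sup>+s. ennreal (- h0 s) \<partial>lebesgue) \<noteq> \<infinity>"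
    using int unfolding real_integrable_def by auto
  then show "has_average a b h"
    unfolding has_average_def p n by (simp add: less_top)
  obtain P N where PN: "0 \<le> P" "0 \<le> N" "(\<integral>\<^sup>+s. ennreal (h0 s) \<partial>lebesgue) = ennreal P"
    "(\<integral>\<^sup>+s. ennreal (- h0 s) \<partial>lebesgue) = ennreal N"
    using fin by (metis ennreal_cases infinity_ennreal_def)
  have "(LINT s:{a..b}|lebesgue. h s) = V"
    using set_lebesgue_integral_eq_integral(2)[OF h] V by (simp add: integral_unique)
  then have "P - N = V"
    using real_lebesgue_integral_def[OF int] PN unfolding set_lebesgue_integral_def h0_def[symmetric] by simp
  then show "ext_average a b h = ereal (V / (b - a))"
    unfolding ext_average_def p n PN(3,4) using PN(1,2) ab by simp
qed

lemma bounded_integrable_imp_set_integrable: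
  fixes h :: "real \<Rightarrow> real"
  assumes "h integrable_on {a..b}" "\<And>r. \<bar>h r\<bar> \<le> B"
  shows "set_integrable lebesgue {a..b} h"
  by (rule measurable_bounded_by_integrable_imp_absolutely_integrable[where g = "\<lambda>_. B"])
    (use assms integrable_imp_measurable in auto)

locale family_path = family_strip emax G \<epsilon> +
  tangential_path "\<lambda>t. fst (G t 0)" "\<lambda>t. snd (G t 0)" "curve_slope G 0"
    "deriv (\<lambda>t. fst (G t 0))" "deriv (curve_slope G 0)"
    "\<lambda>t. fst (G t \<epsilon>)" "\<lambda>t. snd (G t \<epsilon>)" "curve_slope G \<epsilon>"
    "deriv (\<lambda>t. fst (G t \<epsilon>))" "deriv (curve_slope G \<epsilon>)" E a b \<sigma> \<tau> u \<alpha> \<beta>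
  for emax G \<epsilon> E a b \<sigma> \<tau> u \<alpha> \<beta>
begin

definition \<phi> :: "real \<Rightarrow> real \<times> real" where "\<phi> r = G (\<theta> r) 0"

lemma set_integrable_along_path:
  fixes h :: "real \<Rightarrow> real"
  assumes "\<And>t. isCont h t" "(\<lambda>r. h (\<theta> r)) integrable_on {a..b}"
  shows "set_integrable lebesgue {a..b} (\<lambda>r. h (\<theta> r))"
proof -
  have "compact (h ` {\<sigma>..u})"
    using assms(1) by (intro compact_continuous_image continuous_at_imp_continuous_on) auto
  then obtain B where "\<forall>w\<in>h ` {\<sigma>..u}. norm w \<le> B"
    using compact_imp_bounded bounded_iff by blast
  then have "\<bar>h t\<bar> \<le> B" if "t \<in> {\<sigma>..u}" for t using that by simp
  then show ?thesis using \<theta>_range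
    by (intro bounded_integrable_imp_set_integrable[where B = B] assms(2)) auto
qed

lemma \<phi>_coordinates: "\<phi> r = fst (G (\<theta> r) 0) *\<^sub>R (1, 0) + snd (G (\<theta> r) 0) *\<^sub>R (0, 1)"
  by (simp add: \<phi>_def)

lemma \<phi>_integrable: "set_integrable lebesgue {a..b} \<phi>"
proof -
  have x: "set_integrable lebesgue {a..b} (\<lambda>r. fst (G (\<theta> r) 0))"
    using set_integrable_along_path[OF fixed.cont_X] primitive_onD[OF primitive_x, of a b] a_less_b
    by (auto intro: has_integral_integrable)
  have y: "set_integrable lebesgue {a..b} (\<lambda>r. snd (G (\<theta> r) 0))"
    using set_integrable_along_path[OF fixed.cont_Y] primitive_onD[OF primitive_y, of a b] a_less_b
    by (auto intro: has_integral_integrable)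
  have "set_integrable lebesgue {a..b} (\<lambda>r. fst (G (\<theta> r) 0) *\<^sub>R (1::real, 0::real) + snd (G (\<theta> r) 0) *\<^sub>R (0, 1))"
    using absolutely_integrable_linear[OF x bounded_linear_scaleR_left[of "(1 :: real, 0 :: real)"]]
      absolutely_integrable_linear[OF y bounded_linear_scaleR_left[of "(0 :: real, 1 :: real)"]]
    by (intro set_integral_add) (simp_all add: o_def)
  then show ?thesis by (simp add: \<phi>_coordinates[abs_def])
qed

lemma \<phi>_average:
  assumes cd: "a \<le> c" "c < d" "d \<le> b"
    and zx: "((\<lambda>r. fst (G (\<theta> r) 0)) has_integral (d - c) * z1) {c..d}"
    and zy: "((\<lambda>r. snd (G (\<theta> r) 0)) has_integral (d - c) * z2) {c..d}"
  shows "average c d \<phi> = (z1, z2)"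
proof -
  have "set_integrable lebesgue {c..d} \<phi>"
    by (rule set_integrable_subset[OF \<phi>_integrable]) (use cd in auto)
  then have "(LINT s:{c..d}|lebesgue. \<phi> s) = integral {c..d} \<phi>"
    by (rule set_lebesgue_integral_eq_integral(2))
  also have "(\<phi> has_integral ((d - c) * z1) *\<^sub>R (1, 0) + ((d - c) * z2) *\<^sub>R (0, 1)) {c..d}"
    unfolding \<phi>_coordinates[abs_def]
    by (intro has_integral_add has_integral_scaleR_left zx zy)
  then have "integral {c..d} \<phi> = ((d - c) * z1, (d - c) * z2)" by (simp add: integral_unique)
  finally show ?thesis using cd by (simp add: average_def)
qed

lemma \<phi>_in_A_class: "\<phi> \<in> A_class G \<epsilon> a b"
proof -
  have "average c d \<phi> \<in> Omega G \<epsilon>" if cd: "a \<le> c" "c < d" "d \<le> b" for c d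
  proof -
    obtain I1 I2 where I: "((\<lambda>r. fst (G (\<theta> r) 0)) has_integral I1) {c..d}"
      "((\<lambda>r. snd (G (\<theta> r) 0)) has_integral I2) {c..d}"
      using primitive_onD[OF primitive_x, of c d] primitive_onD[OF primitive_y, of c d] cd by auto
    have I': "((\<lambda>r. fst (G (\<theta> r) 0)) has_integral (d - c) * (I1 / (d - c))) {c..d}"
      "((\<lambda>r. snd (G (\<theta> r) 0)) has_integral (d - c) * (I2 / (d - c))) {c..d}"
      using I cd by simp_all
    show ?thesis
      unfolding \<phi>_average[OF cd I'] Omega_eq_region by (rule region_averages[OF cd I'])
  qed
  then show ?thesis
    using \<phi>_integrable unfolding A_class_def by (auto simp: \<phi>_def fixed_boundary_def)
qed

lemma average_\<phi>:
  "average a b \<phi> = (\<beta> * fst (G (R u) \<epsilon>) + (1 - \<beta>) * fst (G u 0), \<beta> * snd (G (R u) \<epsilon>) + (1 - \<beta>) * snd (G u 0))"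
proof (rule \<phi>_average)
  show "((\<lambda>r. fst (G (\<theta> r) 0)) has_integral (b - a) * (\<beta> * fst (G (R u) \<epsilon>) + (1 - \<beta>) * fst (G u 0))) {a..b}"
    using primitive_onD[OF primitive_x, of a b] a_less_b by (simp add: prim_start prim_end)
  show "((\<lambda>r. snd (G (\<theta> r) 0)) has_integral (b - a) * (\<beta> * snd (G (R u) \<epsilon>) + (1 - \<beta>) * snd (G u 0))) {a..b}"
    using primitive_onD[OF primitive_y, of a b] a_less_b by (simp add: prim_start prim_end)
qed (use a_less_b in auto)

lemma boundary_fun_\<phi>: "boundary_fun G f (\<phi> r) = f (\<theta> r)"
proof -
  have "inj (\<lambda>t. G t 0)" by (rule injI) (metis fixed.X_eq_iff)
  then have "inv (\<lambda>t. G t 0) (G (\<theta> r) 0) = \<theta> r" by (rule inv_f_f)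
  then show ?thesis by (simp add: boundary_fun_def \<phi>_def)
qed

lemma ext_average_\<phi>:
  assumes f: "\<And>t. isCont f t" and A: "\<And>t. (A has_real_derivative f t * lam t * E t) (at t)"
  defines "V \<equiv> \<beta> * ((A u - A \<tau> + E \<tau> * (\<alpha> * f \<sigma> + (1 - \<alpha>) * f \<tau>)) / E u) + (1 - \<beta>) * f u"
  shows "has_average a b (\<lambda>r. boundary_fun G f (\<phi> r))"
    "ext_average a b (\<lambda>r. boundary_fun G f (\<phi> r)) = ereal V"
proof -
  have int: "((\<lambda>r. f (\<theta> r)) has_integral (b - a) * V) {a..b}"
    using primitive_onD[OF integral_along_path[OF A], of a b] a_less_b
    by (simp add: prim_start prim_end V_def)
  then have abs: "set_integrable lebesgue {a..b} (\<lambda>r. f (\<theta> r))"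
    by (intro set_integrable_along_path f) (rule has_integral_integrable)
  show "has_average a b (\<lambda>r. boundary_fun G f (\<phi> r))"
    "ext_average a b (\<lambda>r. boundary_fun G f (\<phi> r)) = ereal V"
    using ext_average_eq[OF abs int a_less_b] a_less_b by (simp_all add: boundary_fun_\<phi>)
qed

text \<open>
  The average of the boundary function along the path, as a lower bound of the Bellman function.
\<close>

lemma Bellman_ge:
  assumes f: "\<And>t. isCont f t" and A: "\<And>t. (A has_real_derivative f t * lam t * E t) (at t)"
  shows "ereal (\<beta> * ((A u - A \<tau> + E \<tau> * (\<alpha> * f \<sigma> + (1 - \<alpha>) * f \<tau>)) / E u) + (1 - \<beta>) * f u)
    \<le> Bellman G \<epsilon> a b f
        (\<beta> * fst (G (R u) \<epsilon>) + (1 - \<beta>) * fst (G u 0), \<beta> * snd (G (R u) \<epsilon>) + (1 - \<beta>) * snd (G u 0))"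
  unfolding Bellman_def
  by (rule Sup_upper, rule CollectI, rule exI[of _ \<phi>])
    (simp add: \<phi>_in_A_class average_\<phi> ext_average_\<phi>[OF f A])

end

context family_strip
begin

lemma exponential_weight:
  obtains E where "\<And>t. (E has_real_derivative lam t * E t) (at t)" "\<And>t. 0 < E t"
    "\<And>t. theta_1 G \<epsilon> v t = (fst (G t 0) - fst (G (R t) \<epsilon>)) * E t"
proof -
  obtain H where H: "\<And>t. (H has_real_derivative lam t) (at t)"
    using antiderivative_on_line[of lam] cont_lam by (metis continuous_at_imp_continuous_on)
  have int: "(LBINT s=ereal t..ereal v. lambda_R G s \<epsilon>) = H v - H t" for t
    unfolding lambda_R_eq
  proof (rule interval_integral_FTC_finite)
    show "continuous_on {min t v..max t v} lam"
      using cont_lam by (intro continuous_at_imp_continuous_on) auto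
    show "(H has_vector_derivative lam s) (at s within {min t v..max t v})" for s
      using H by (simp add: has_real_derivative_iff_has_vector_derivative has_vector_derivative_at_within)
  qed
  show ?thesis
  proof (rule that[of "\<lambda>t. exp (H t - H v)"])
    show "((\<lambda>t. exp (H t - H v)) has_real_derivative lam t * exp (H t - H v)) (at t)" for t
      by (auto intro!: derivative_eq_intros H)
    show "theta_1 G \<epsilon> v t = (fst (G t 0) - fst (G (R t) \<epsilon>)) * exp (H t - H v)" for t
      by (simp add: theta_1_def int w_R_def s_R_eq)
  qed simp
qed

text \<open>
  The starting chord exists for every \<open>\<tau>\<close>: the tangent line through \<open>g(\<tau>)\<close> meets the lower arc once
  more, beyond the point of tangency.
\<close>

lemma far_chord:
  obtains \<sigma> \<alpha> where "\<sigma> < \<tau>" "0 < \<alpha>" "\<alpha> < 1" "free.tangent (R \<tau>) (fst (G \<sigma> 0)) = snd (G \<sigma> 0)"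
    "fst (G (R \<tau>) \<epsilon>) = \<alpha> * fst (G \<sigma> 0) + (1 - \<alpha>) * fst (G \<tau> 0)"
proof -
  obtain \<sigma> where \<sigma>: "free.tangent (R \<tau>) (fst (G \<sigma> 0)) = snd (G \<sigma> 0)"
    "fst (G \<sigma> 0) < fst (G (R \<tau>) \<epsilon>)" "\<sigma> < \<tau>"
    using secant_around_tangency[OF R_props(2)[of \<tau>]] R_props(1)[of \<tau>] by (metis less_asym)
  define \<alpha> where "\<alpha> = (fst (G \<tau> 0) - fst (G (R \<tau>) \<epsilon>)) / (fst (G \<tau> 0) - fst (G \<sigma> 0))"
  have d: "fst (G \<sigma> 0) < fst (G \<tau> 0)" using \<sigma>(3) by simp
  have \<alpha>: "\<alpha> * (fst (G \<tau> 0) - fst (G \<sigma> 0)) = fst (G \<tau> 0) - fst (G (R \<tau>) \<epsilon>)"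
    using d by (simp add: \<alpha>_def)
  show ?thesis
  proof (rule that[OF \<sigma>(3) _ _ \<sigma>(1)])
    show "0 < \<alpha>" "\<alpha> < 1" using R_props(1)[of \<tau>] \<sigma>(2) d by (simp_all add: \<alpha>_def del: fixed.X_less_iff)
    show "fst (G (R \<tau>) \<epsilon>) = \<alpha> * fst (G \<sigma> 0) + (1 - \<alpha>) * fst (G \<tau> 0)"
      using \<alpha> by (simp add: algebra_simps)
  qed
qed

text \<open>
  With \<open>A' = f \<lambda> E\<close>, the path started at \<open>\<tau>\<close> yields, up to the constants \<open>\<beta> / E u\<close> and \<open>(1 - \<beta>) f u\<close>, the
  value \<open>A u - A \<tau> + E \<tau> (\<alpha> f \<sigma> + (1 - \<alpha>) f \<tau>)\<close>.  The chord adds at least \<open>K \<vartheta>\<^sub>1 \<tau>\<close> to \<open>E \<tau> f \<tau>\<close>, and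
  \<open>A \<tau> - E \<tau> f \<tau>\<close> is bounded above as \<open>\<tau> \<rightarrow> -\<infinity>\<close>, because its derivative is \<open>- f' E\<close>, which is
  nonnegative near \<open>-\<infinity>\<close>.
\<close>

theorem Bellman_infinite:
  assumes C2: "C2_smooth f"
    and \<theta>: "(theta_1 G \<epsilon> v \<longlongrightarrow> L) at_bot" "0 < L"
    and \<kappa>: "filterlim (kappa_3 G f) at_bot at_bot"
    and ab: "a < b"
    and p: "p \<in> Omega G \<epsilon> - fixed_boundary G"
  shows "Bellman G \<epsilon> a b f p = \<infinity>"
proof (rule ereal_top)
  fix M :: real
  have f': "(f has_real_derivative deriv f t) (at t)" for t
    using C2 by (simp add: C2_smooth_def DERIV_deriv_iff_real_differentiable)
  have f_cont: "isCont f t" for t using f' by (rule DERIV_isCont)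
  have f'_eq: "deriv f t = kappa_3 G f t * deriv (\<lambda>t. fst (G t 0)) t" for t
    using fixed.X'_pos[of t] by (simp add: kappa_3_def)
  obtain E where E: "\<And>t. (E has_real_derivative lam t * E t) (at t)" "\<And>t. 0 < E t"
    "\<And>t. theta_1 G \<epsilon> v t = (fst (G t 0) - fst (G (R t) \<epsilon>)) * E t"
    by (rule exponential_weight[of v]) blast
  obtain A where A: "\<And>t. (A has_real_derivative f t * lam t * E t) (at t)"
  proof (rule antiderivative_on_line[of "\<lambda>t. f t * lam t * E t"])
    show "continuous_on UNIV (\<lambda>t. f t * lam t * E t)"
      using f_cont cont_lam E(1) by (intro continuous_at_imp_continuous_on ballI continuous_intros)
        (blast intro: DERIV_isCont)+
  qed blast
  have "p \<in> region" "p \<noteq> (fst (G t 0), snd (G t 0))" for t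
    using p by (auto simp: Omega_eq_region fixed_boundary_def)
  then obtain u \<beta> where u: "0 < \<beta>" "\<beta> \<le> 1" "fst p = \<beta> * fst (G (R u) \<epsilon>) + (1 - \<beta>) * fst (G u 0)"
    "snd p = \<beta> * snd (G (R u) \<epsilon>) + (1 - \<beta>) * snd (G u 0)"
    by (rule region_right_tangent)
  obtain t1 where t1: "\<And>t. t \<le> t1 \<Longrightarrow> kappa_3 G f t \<le> 0"
    using \<kappa> unfolding filterlim_at_bot eventually_at_bot_linorder by blast
  define c0 where "c0 = A t1 - E t1 * f t1"
  \<comment> \<open>The slope bound for which half of the limit of \<open>\<vartheta>\<^sub>1\<close> already yields the value \<open>M\<close>.\<close>
  define K where "K = max 0 (((M - (1 - \<beta>) * f u) * E u / \<beta> - A u + c0) / (L / 2))"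
  have K: "0 \<le> K" "M \<le> \<beta> * ((A u - c0 + K * (L / 2)) / E u) + (1 - \<beta>) * f u"
  proof -
    show "0 \<le> K" by (simp add: K_def)
    have "((M - (1 - \<beta>) * f u) * E u / \<beta> - A u + c0) / (L / 2) \<le> K" by (simp add: K_def)
    then have "(M - (1 - \<beta>) * f u) * E u / \<beta> - A u + c0 \<le> K * (L / 2)"
      using \<open>0 < L\<close> by (simp add: divide_le_eq)
    then have "(M - (1 - \<beta>) * f u) * E u / \<beta> \<le> A u - c0 + K * (L / 2)" by linarith
    then have "(M - (1 - \<beta>) * f u) * E u \<le> \<beta> * (A u - c0 + K * (L / 2))"
      using u(1) by (simp add: divide_le_eq mult.commute)
    then have "M - (1 - \<beta>) * f u \<le> \<beta> * (A u - c0 + K * (L / 2)) / E u"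
      using E(2)[of u] by (simp add: le_divide_eq)
    then show "M \<le> \<beta> * ((A u - c0 + K * (L / 2)) / E u) + (1 - \<beta>) * f u" by simp
  qed
  obtain \<tau>1 where \<tau>1: "\<And>t. t \<le> \<tau>1 \<Longrightarrow> kappa_3 G f t \<le> - K"
    using \<kappa> unfolding filterlim_at_bot eventually_at_bot_linorder by blast
  obtain \<tau>2 where \<tau>2: "\<And>t. t \<le> \<tau>2 \<Longrightarrow> L / 2 < theta_1 G \<epsilon> v t"
    using order_tendstoD(1)[OF \<theta>(1), of "L / 2"] \<theta>(2) unfolding eventually_at_bot_linorder by auto
  define \<tau> where "\<tau> = min (min \<tau>1 \<tau>2) (min t1 (u - 1))"
  have \<tau>: "\<tau> \<le> \<tau>1" "\<tau> \<le> \<tau>2" "\<tau> \<le> t1" "\<tau> < u" by (auto simp: \<tau>_def)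
  obtain \<sigma> \<alpha> where \<sigma>: "\<sigma> < \<tau>" "0 < \<alpha>" "\<alpha> < 1" "free.tangent (R \<tau>) (fst (G \<sigma> 0)) = snd (G \<sigma> 0)"
    "fst (G (R \<tau>) \<epsilon>) = \<alpha> * fst (G \<sigma> 0) + (1 - \<alpha>) * fst (G \<tau> 0)"
    by (rule far_chord)
  interpret path: family_path emax G \<epsilon> E a b \<sigma> \<tau> u \<alpha> \<beta>
    by unfold_locales (use E ab \<sigma> \<tau> u in auto)
  have jump: "f \<tau> + K * (fst (G \<tau> 0) - fst (G (R \<tau>) \<epsilon>)) \<le> \<alpha> * f \<sigma> + (1 - \<alpha>) * f \<tau>"
  proof -
    have "f \<tau> + K * fst (G \<tau> 0) \<le> f \<sigma> + K * fst (G \<sigma> 0)"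
    proof (rule DERIV_nonpos_imp_nonincreasing[where f = "\<lambda>t. f t + K * fst (G t 0)"])
      fix t assume "t \<le> \<tau>"
      then have "(kappa_3 G f t + K) * deriv (\<lambda>t. fst (G t 0)) t \<le> 0"
        using \<tau>1[of t] \<tau>(1) fixed.X'_pos[of t] by (intro mult_nonpos_nonneg) auto
      then have "deriv f t + K * deriv (\<lambda>t. fst (G t 0)) t \<le> 0"
        by (simp add: f'_eq algebra_simps)
      moreover have "((\<lambda>t. f t + K * fst (G t 0)) has_real_derivative deriv f t + K * deriv (\<lambda>t. fst (G t 0)) t) (at t)"
        by (intro DERIV_add DERIV_cmult f' fixed.deriv_X)
      ultimately show "\<exists>D. ((\<lambda>t. f t + K * fst (G t 0)) has_real_derivative D) (at t) \<and> D \<le> 0" by blast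
    qed (use \<sigma>(1) in simp)
    then have "\<alpha> * (K * (fst (G \<tau> 0) - fst (G \<sigma> 0))) \<le> \<alpha> * (f \<sigma> - f \<tau>)"
      using \<sigma>(2) by (intro mult_left_mono) (auto simp: algebra_simps)
    then show ?thesis unfolding \<sigma>(5) by (simp add: algebra_simps)
  qed
  have "A \<tau> - E \<tau> * f \<tau> \<le> c0"
    unfolding c0_def
  proof (rule DERIV_nonneg_imp_nondecreasing[where f = "\<lambda>t. A t - E t * f t"])
    fix t assume "t \<le> t1"
    then have "kappa_3 G f t * deriv (\<lambda>t. fst (G t 0)) t \<le> 0"
      using t1[of t] fixed.X'_pos[of t] by (intro mult_nonpos_nonneg) auto
    then have "0 \<le> - (deriv f t * E t)" using E(2)[of t] by (simp add: f'_eq mult_le_0_iff)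
    moreover have "((\<lambda>t. A t - E t * f t) has_real_derivative - (deriv f t * E t)) (at t)"
      by (rule derivative_eq_intros A E(1) f' refl)+ simp
    ultimately show "\<exists>D. ((\<lambda>t. A t - E t * f t) has_real_derivative D) (at t) \<and> 0 \<le> D" by blast
  qed (use \<tau>(3) in simp)
  moreover have "E \<tau> * (f \<tau> + K * (fst (G \<tau> 0) - fst (G (R \<tau>) \<epsilon>))) \<le> E \<tau> * (\<alpha> * f \<sigma> + (1 - \<alpha>) * f \<tau>)"
    using jump E(2)[of \<tau>] by (intro mult_left_mono) auto
  moreover have "K * (L / 2) \<le> K * ((fst (G \<tau> 0) - fst (G (R \<tau>) \<epsilon>)) * E \<tau>)"
    using \<tau>2[OF \<tau>(2)] K(1) unfolding E(3) by (intro mult_left_mono) auto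
  ultimately have "A u - c0 + K * (L / 2) \<le> A u - A \<tau> + E \<tau> * (\<alpha> * f \<sigma> + (1 - \<alpha>) * f \<tau>)"
    by (simp add: algebra_simps)
  then have "\<beta> * ((A u - c0 + K * (L / 2)) / E u) \<le> \<beta> * ((A u - A \<tau> + E \<tau> * (\<alpha> * f \<sigma> + (1 - \<alpha>) * f \<tau>)) / E u)"
    using u(1) E(2)[of u] by (intro mult_left_mono divide_right_mono) auto
  then have "ereal M \<le> ereal (\<beta> * ((A u - A \<tau> + E \<tau> * (\<alpha> * f \<sigma> + (1 - \<alpha>) * f \<tau>)) / E u) + (1 - \<beta>) * f u)"
    using K(2) by simp
  also have "\<dots> \<le> Bellman G \<epsilon> a b f p"
    using path.Bellman_ge[OF f_cont A] u(3,4) by (metis prod.collapse)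
  finally show "ereal M \<le> Bellman G \<epsilon> a b f p" .
qed

end

theorem proposition5p4p12:
  fixes emax :: ereal and G :: "real \<Rightarrow> real \<Rightarrow> real \<times> real"
    and f :: "real \<Rightarrow> real" and \<epsilon> v a b :: real and x :: "real \<times> real"
  assumes "curve_family emax G"
    and "0 < \<epsilon>" and "ereal \<epsilon> < emax"
    and "regular_function G f"
    and "filterlim (\<lambda>\<tau>. LBINT s=ereal \<tau>..ereal v. lambda_R G s \<epsilon>) at_top at_bot"
    and "\<exists>L>0. (theta_1 G \<epsilon> v \<longlongrightarrow> L) at_bot"
    and "filterlim (kappa_3 G f) at_bot at_bot"
    and "a < b"
    and "x \<in> Omega G \<epsilon> - fixed_boundary G"
  shows "Bellman G \<epsilon> a b f x = \<infinity>"
proof -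
  interpret curve_family emax G by fact
  interpret family_strip emax G \<epsilon> by unfold_locales fact+
  obtain L where "0 < L" "(theta_1 G \<epsilon> v \<longlongrightarrow> L) at_bot" using assms(6) by blast
  then show ?thesis
    using Bellman_infinite[of f v L a b x] assms by (simp add: regular_function_def)
qed

end
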